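(* Let $K=\sqrt{\dfrac{(\dot G_{11}^+)^2+(\dot G_{12}^+)^2}{c^2}}$ and $M=\dfrac{|\dot v_1^+|}{c}$, and suppose that $$K+\epsilon_0\le M\le\sqrt{2+K^2}-\epsilon_0,$$ where $\epsilon_0>0$ is a small fixed constant. Then the linear equations (L) with the boundary conditions (B) of the context are ill-posed in the sense of Hadamard in $H^k(\Omega)$ for every $k$. More precisely, for any $k,j\in\mathbb{N}$ with $j\ge k$ and for any $T_0>0$ and $\alpha>0$, there exists a sequence $\{(f_n,h_n,v_n,G_{n,l})\}_{n=1}^\infty$ ($l=1,2$) of solutions of (L) satisfying (B) such that $$\|(f_n(0),h_n(0),v_n(0),G_{n,l}(0))\|_{H^j}\lesssim\frac1n,$$ but $$\|(f_n(t),h_n(t),v_n(t),G_{n,l}(t))\|_{H^k}\ge\alpha\qquad\text{for all }t\ge T_0.$$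
   Context: $\Omega^\pm=\{x\in\mathbb{R}^2:\pm x_2>0\}$, $\Gamma=\{x_2=0\}$; "in $\Omega$" means in both $\Omega^+$ and $\Omega^-$. For a function $\phi$ on $\Omega$, $\phi^\pm$ are its restrictions to $\Omega^\pm$ and $[\phi]=\phi^+|_\Gamma-\phi^-|_\Gamma$; $e_2=(0,1)$. Background constants: the sound speed $c>0$ (at the constant background density), the velocities $\dot v_1^\pm$ with $\dot v_1^+=-\dot v_1^-$, and $\dot G_{1j}^\pm$ ($j=1,2$) with $\dot G_{1j}^+=-\dot G_{1j}^-$. In an equation on $\Omega^\pm$ (or in its trace on $\Gamma$ from the $\pm$ side), $\dot v_1$ and $\dot G_{1j}$ stand for $\dot v_1^\pm$ and $\dot G_{1j}^\pm$. Unknowns: the front $f(t,x_1)$; and on $\Omega$, the scalar $h$, the velocity $v=(v_1,v_2)$, and $G_j=(G_{1j},G_{2j})$, $j=1,2$. The linearized elastic Kelvin-Helmholtz system around the rectilinear solution is (L) $$\begin{cases}\partial_th+\dot v_1\partial_1h+\operatorname{div}v=0&\text{in }\Omega,\\ \partial_tv+\dot v_1\partial_1v+c^2\nabla h=\sum_{j=1}^2\dot G_{1j}\partial_1G_j&\text{in }\Omega,\\ \partial_tG_j+\dot v_1\partial_1G_j=\dot G_{1j}\partial_1v&\text{in }\Omega,\\ \partial_tf=v_2-\dot v_1\partial_1f&\text{on }\Gamma\ (\text{from both sides}),\end{cases}$$ (B) $[h]=0$, $[v\cdot e_2]=2\dot v_1^+\partial_1f$, and $G_{2j}-\dot G_{1j}\partial_1f=0$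 on $\Gamma$ (from both sides, $j=1,2$). Norms: $\|\phi\|^2_{H^k(\Omega)}=\|\phi^+\|^2_{H^k(\Omega^+)}+\|\phi^-\|^2_{H^k(\Omega^-)}$ (piecewise Sobolev norm), and $\|(f,h,v,G_l)\|_{H^k}=\|f\|_{H^k(\Gamma)}+\|h\|_{H^k(\Omega)}+\|v\|_{H^k(\Omega)}+\|G_l\|_{H^k(\Omega)}$. $a\lesssim b$ means $a\le Cb$ with a constant $C>0$ that may depend on the parameters of the problem but not on the data (in particular not on $n$). *)

theory Defs
  imports "HOL-Analysis.Analysis" "HOL-Library.Multiset"
begin

section \<open>Sobolev spaces\<close>

definition pd :: "'a::euclidean_space \<Rightarrow> ('a \<Rightarrow> 'b::real_normed_vector) \<Rightarrow> 'a \<Rightarrow> 'b" where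
  "pd b u x = vector_derivative (\<lambda>s. u (x + s *\<^sub>R b)) (at 0)"

definition pds :: "'a::euclidean_space list \<Rightarrow> ('a \<Rightarrow> 'b::real_normed_vector) \<Rightarrow> 'a \<Rightarrow> 'b" where
  "pds bs u = foldr pd bs u"

definition test_function :: "'a::euclidean_space set \<Rightarrow> ('a \<Rightarrow> real) \<Rightarrow> bool" where
  "test_function U \<phi> \<longleftrightarrow>
     (\<forall>bs\<in>lists Basis. pds bs \<phi> differentiable_on UNIV) \<and>
     compact (closure {x. \<phi> x \<noteq> 0}) \<and> closure {x. \<phi> x \<noteq> 0} \<subseteq> U"

text \<open>A multi-index is a multiset of basis vectors; the multiplicity of a basis vector is the
  number of derivatives taken in its direction.\<close>

definition multi_indices :: "nat \<Rightarrow> 'a::euclidean_space multiset set" where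
  "multi_indices k = {\<alpha>. set_mset \<alpha> \<subseteq> Basis \<and> size \<alpha> \<le> k}"

definition square_integrable_on :: "('a::euclidean_space \<Rightarrow> 'b::euclidean_space) \<Rightarrow> 'a set \<Rightarrow> bool"
    (infix "square'_integrable'_on" 50) where
  "u square_integrable_on U \<longleftrightarrow>
     set_borel_measurable lebesgue U u \<and> set_integrable lebesgue U (\<lambda>x. (norm (u x))\<^sup>2)"

definition weak_derivative ::
    "'a::euclidean_space set \<Rightarrow> 'a multiset \<Rightarrow> ('a \<Rightarrow> 'b::euclidean_space) \<Rightarrow> ('a \<Rightarrow> 'b) \<Rightarrow> bool" where
  "weak_derivative U \<alpha> u w \<longleftrightarrow>
     (\<forall>\<phi> bs. test_function U \<phi> \<longrightarrow> mset bs = \<alpha> \<longrightarrow>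
        (LINT x:U|lebesgue. pds bs \<phi> x *\<^sub>R u x)
          = (-1) ^ size \<alpha> *\<^sub>R (LINT x:U|lebesgue. \<phi> x *\<^sub>R w x))"

text \<open>\<open>W\<close> collects the weak derivatives of \<open>u\<close> up to order \<open>k\<close>, all of them square integrable.\<close>

definition weak_jet ::
    "'a::euclidean_space set \<Rightarrow> nat \<Rightarrow> ('a \<Rightarrow> 'b::euclidean_space) \<Rightarrow>
     ('a multiset \<Rightarrow> 'a \<Rightarrow> 'b) \<Rightarrow> bool" where
  "weak_jet U k u W \<longleftrightarrow>
     W {#} = u \<and> (\<forall>\<alpha>\<in>multi_indices k. W \<alpha> square_integrable_on U \<and> weak_derivative U \<alpha> u (W \<alpha>))"

definition sobolev :: "'a::euclidean_space set \<Rightarrow> nat \<Rightarrow> ('a \<Rightarrow> 'b::euclidean_space) set" where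
  "sobolev U k = {u. \<exists>W. weak_jet U k u W}"

text \<open>Weak derivatives on an open set are unique up to null sets, so for \<open>u \<in> sobolev U k\<close> the
  infimum is over a single value, the sum of the squared \<open>L\<^sup>2\<close> norms of the weak derivatives
  of order at most \<open>k\<close>.  The norm is meaningful only for \<open>u \<in> sobolev U k\<close>.\<close>

definition sobolev_norm :: "'a::euclidean_space set \<Rightarrow> nat \<Rightarrow> ('a \<Rightarrow> 'b::euclidean_space) \<Rightarrow> real" where
  "sobolev_norm U k u =
     sqrt (INF W\<in>{W. weak_jet U k u W}.
       \<Sum>\<alpha>\<in>multi_indices k. LINT x:U|lebesgue. (norm (W \<alpha> x))\<^sup>2)"

section \<open>The two half-planes and their interface\<close>

datatype side = Plus | Minus

text \<open>Points of the plane are pairs \<open>(x\<^sub>1, x\<^sub>2)\<close>, and the interface is identified with the real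
  line through \<open>x\<^sub>1\<close>.  Fields on the union of the two half-planes are total functions whose
  values on the interface itself are never used.\<close>

fun halfplane :: "side \<Rightarrow> (real \<times> real) set" where
  "halfplane Plus = {x. snd x > 0}"
| "halfplane Minus = {x. snd x < 0}"

definition piecewise_sobolev :: "nat \<Rightarrow> (real \<times> real \<Rightarrow> 'b::euclidean_space) set" where
  "piecewise_sobolev k = sobolev (halfplane Plus) k \<inter> sobolev (halfplane Minus) k"

definition piecewise_sobolev_norm :: "nat \<Rightarrow> (real \<times> real \<Rightarrow> 'b::euclidean_space) \<Rightarrow> real" where
  "piecewise_sobolev_norm k u =
     sqrt ((sobolev_norm (halfplane Plus) k u)\<^sup>2 + (sobolev_norm (halfplane Minus) k u)\<^sup>2)"

definition side_trace :: "side \<Rightarrow> (real \<times> real \<Rightarrow> real) \<Rightarrow> real \<Rightarrow> real" where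
  "side_trace s u x1 = Lim (at (x1, 0) within halfplane s) u"

definition jump :: "(real \<times> real \<Rightarrow> real) \<Rightarrow> real \<Rightarrow> real" where
  "jump u x1 = side_trace Plus u x1 - side_trace Minus u x1"

abbreviation e2 :: "real \<times> real" where "e2 \<equiv> (0, 1)"
abbreviation d1 :: "(real \<times> real \<Rightarrow> 'b::real_normed_vector) \<Rightarrow> real \<times> real \<Rightarrow> 'b" where
  "d1 \<equiv> pd (1, 0)"
abbreviation d2 :: "(real \<times> real \<Rightarrow> 'b::real_normed_vector) \<Rightarrow> real \<times> real \<Rightarrow> 'b" where
  "d2 \<equiv> pd (0, 1)"

definition grad :: "(real \<times> real \<Rightarrow> real) \<Rightarrow> real \<times> real \<Rightarrow> real \<times> real" where
  "grad u x = (d1 u x, d2 u x)"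

definition divergence :: "(real \<times> real \<Rightarrow> real \<times> real) \<Rightarrow> real \<times> real \<Rightarrow> real" where
  "divergence w x = fst (d1 w x) + snd (d2 w x)"

section \<open>Regularity of solutions\<close>

text \<open>Time runs over \<open>[0, \<infinity>)\<close>; the time derivative is one-sided at \<open>0\<close>.\<close>

definition dt :: "(real \<Rightarrow> 'a \<Rightarrow> 'b::real_normed_vector) \<Rightarrow> real \<Rightarrow> 'a \<Rightarrow> 'b" where
  "dt u t x = vector_derivative (\<lambda>\<tau>. u \<tau> x) (at t within {0..})"

definition C1_on :: "'a::euclidean_space set \<Rightarrow> (real \<Rightarrow> 'a \<Rightarrow> 'b::euclidean_space) \<Rightarrow> bool" where
  "C1_on U u \<longleftrightarrow>
     (\<forall>t\<ge>0. \<forall>x\<in>U. (\<lambda>\<tau>. u \<tau> x) differentiable (at t within {0..}) \<and> u t differentiable (at x)) \<and>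
     continuous_on ({0..} \<times> U) (\<lambda>(t, x). dt u t x) \<and>
     (\<forall>b\<in>Basis. continuous_on ({0..} \<times> U) (\<lambda>(t, x). pd b (u t) x))"

text \<open>The restriction of the field to one side extends continuously up to the interface, so that
  its trace there is a genuine limit.\<close>

definition extends_continuously :: "side \<Rightarrow> (real \<Rightarrow> real \<times> real \<Rightarrow> 'b::euclidean_space) \<Rightarrow> bool" where
  "extends_continuously s u \<longleftrightarrow>
     (\<exists>w. continuous_on ({0..} \<times> closure (halfplane s)) w \<and>
          (\<forall>t\<ge>0. \<forall>x\<in>halfplane s. w (t, x) = u t x))"

definition classical_front :: "(real \<Rightarrow> real \<Rightarrow> real) \<Rightarrow> bool" where
  "classical_front f \<longleftrightarrow> C1_on UNIV f"

definition classical_field :: "(real \<Rightarrow> real \<times> real \<Rightarrow> 'b::euclidean_space) \<Rightarrow> bool" where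
  "classical_field u \<longleftrightarrow> (\<forall>s. C1_on (halfplane s) u \<and> extends_continuously s u)"

text \<open>Continuity in time with values in the Sobolev space \<open>X\<close> normed by \<open>N\<close>.\<close>

definition continuous_curve ::
    "('a \<Rightarrow> 'b::real_normed_vector) set \<Rightarrow> (('a \<Rightarrow> 'b) \<Rightarrow> real) \<Rightarrow> (real \<Rightarrow> 'a \<Rightarrow> 'b) \<Rightarrow> bool" where
  "continuous_curve X N u \<longleftrightarrow>
     (\<forall>t\<ge>0. u t \<in> X \<and> ((\<lambda>\<tau>. N (\<lambda>x. u \<tau> x - u t x)) \<longlongrightarrow> 0) (at t within {0..}))"

section \<open>The linearized system\<close>

text \<open>The background velocity on side \<open>s\<close> is \<open>vd s\<close>, and \<open>Gd s j\<close> is the background constant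
  with indices \<open>1j\<close>.  The unknown \<open>G j t x\<close> is the column with entries of index \<open>1j\<close> and \<open>2j\<close>;
  only \<open>j \<in> {1, 2}\<close> is used.\<close>

type_synonym front = "real \<Rightarrow> real \<Rightarrow> real"
type_synonym scalar_field = "real \<Rightarrow> real \<times> real \<Rightarrow> real"
type_synonym vector_field = "real \<Rightarrow> real \<times> real \<Rightarrow> real \<times> real"

definition system_L ::
    "real \<Rightarrow> (side \<Rightarrow> real) \<Rightarrow> (side \<Rightarrow> nat \<Rightarrow> real) \<Rightarrow>
     front \<Rightarrow> scalar_field \<Rightarrow> vector_field \<Rightarrow> (nat \<Rightarrow> vector_field) \<Rightarrow> bool" where
  "system_L c vd Gd f h v G \<longleftrightarrow>
     (\<forall>t\<ge>0. \<forall>s.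
        (\<forall>x\<in>halfplane s.
           dt h t x + vd s * d1 (h t) x + divergence (v t) x = 0 \<and>
           dt v t x + vd s *\<^sub>R d1 (v t) x + c\<^sup>2 *\<^sub>R grad (h t) x
             = (\<Sum>j\<in>{1,2}. Gd s j *\<^sub>R d1 (G j t) x) \<and>
           (\<forall>j\<in>{1,2}. dt (G j) t x + vd s *\<^sub>R d1 (G j t) x = Gd s j *\<^sub>R d1 (v t) x)) \<and>
        (\<forall>x1. dt f t x1 = side_trace s (\<lambda>x. snd (v t x)) x1 - vd s * pd 1 (f t) x1))"

definition boundary_B ::
    "(side \<Rightarrow> real) \<Rightarrow> (side \<Rightarrow> nat \<Rightarrow> real) \<Rightarrow>
     front \<Rightarrow> scalar_field \<Rightarrow> vector_field \<Rightarrow> (nat \<Rightarrow> vector_field) \<Rightarrow> bool" where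
  "boundary_B vd Gd f h v G \<longleftrightarrow>
     (\<forall>t\<ge>0. \<forall>x1.
        jump (h t) x1 = 0 \<and>
        jump (\<lambda>x. v t x \<bullet> e2) x1 = 2 * vd Plus * pd 1 (f t) x1 \<and>
        (\<forall>s. \<forall>j\<in>{1,2}. side_trace s (\<lambda>x. snd (G j t x)) x1 - Gd s j * pd 1 (f t) x1 = 0))"

text \<open>Classical solutions on \<open>[0, \<infinity>)\<close> that are continuous in time with values in \<open>H\<^sup>m\<close>.\<close>

definition solution ::
    "real \<Rightarrow> (side \<Rightarrow> real) \<Rightarrow> (side \<Rightarrow> nat \<Rightarrow> real) \<Rightarrow> nat \<Rightarrow>
     front \<Rightarrow> scalar_field \<Rightarrow> vector_field \<Rightarrow> (nat \<Rightarrow> vector_field) \<Rightarrow> bool" where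
  "solution c vd Gd m f h v G \<longleftrightarrow>
     classical_front f \<and> continuous_curve (sobolev UNIV m) (sobolev_norm UNIV m) f \<and>
     classical_field h \<and> continuous_curve (piecewise_sobolev m) (piecewise_sobolev_norm m) h \<and>
     classical_field v \<and> continuous_curve (piecewise_sobolev m) (piecewise_sobolev_norm m) v \<and>
     (\<forall>l\<in>{1,2}. classical_field (G l) \<and>
        continuous_curve (piecewise_sobolev m) (piecewise_sobolev_norm m) (G l)) \<and>
     system_L c vd Gd f h v G \<and> boundary_B vd Gd f h v G"

text \<open>The norm of \<open>(f, h, v, G\<^sub>l)\<close> for one fixed \<open>l\<close>, the arguments being time slices.\<close>

definition state_norm ::
    "nat \<Rightarrow> (real \<Rightarrow> real) \<Rightarrow> (real \<times> real \<Rightarrow> real) \<Rightarrow> (real \<times> real \<Rightarrow> real \<times> real) \<Rightarrow>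
     (real \<times> real \<Rightarrow> real \<times> real) \<Rightarrow> real" where
  "state_norm k f h v Gl =
     sobolev_norm UNIV k f + piecewise_sobolev_norm k h +
     piecewise_sobolev_norm k v + piecewise_sobolev_norm k Gl"

end

theory Submission
  imports Defs "HOL-Complex_Analysis.Complex_Analysis" "HOL-Probability.Sinc_Integral"
begin

text \<open>
  For a frequency \<open>\<xi> > 0\<close> the system has an explicit normal mode: every field is a constant
  times \<open>exp (\<i> \<xi> (x\<^sub>1 - \<i> \<lambda> t + \<i> \<nu> x\<^sub>2))\<close>, where \<open>\<nu>\<close> depends on the side and the real part of
  \<open>\<nu> x\<^sub>2\<close> is positive.  By homogeneity \<open>\<lambda>\<close> and \<open>\<nu>\<close> do not depend on \<open>\<xi>\<close>, and continuity of \<open>h\<close> across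
  the interface reduces to \<open>\<bar>1 + ((\<lambda> + \<i> v)\<^sup>2 + Q) / c\<^sup>2\<bar> = 1\<close> with \<open>v\<close> the velocity and \<open>Q\<close> the sum of
  the squared background constants on the upper side; this has a root \<open>\<lambda> > 0\<close> precisely when
  \<open>K < M < sqrt (2 + K\<^sup>2)\<close>.  Superposing the modes with frequencies in \<open>[n, 2n]\<close> replaces the exponential by
  an entire function \<open>\<Phi> (n z)\<close> that is square integrable together with its derivatives
  on horizontal lines, so the fields lie in every Sobolev space.  Their initial norms
  grow only polynomially in \<open>n\<close>, whereas at time \<open>t\<close> the front is at least of order
  \<open>exp (n \<lambda> t)\<close> near the origin; scaling by a power of \<open>n\<close> gives the sequence.
\<close>

section \<open>Weak derivatives of smooth functions\<close>

lemma has_vector_derivative_quotient: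
  assumes "(g has_vector_derivative d) (at 0)"
  shows "((\<lambda>s. (g s - g 0) /\<^sub>R s) \<longlongrightarrow> d) (at (0::real))"
proof -
  have "((\<lambda>s. norm (g s - g 0 - s *\<^sub>R d) / norm s) \<longlongrightarrow> 0) (at 0)"
    using assms by (simp add: has_vector_derivative_def has_derivative_at)
  then have "((\<lambda>s. (g s - g 0) /\<^sub>R s - d) \<longlongrightarrow> 0) (at 0)"
  proof (rule Lim_transform_eventually[THEN tendsto_norm_zero_cancel])
    show "\<forall>\<^sub>F s in at 0. norm (g s - g 0 - s *\<^sub>R d) / norm s = norm ((g s - g 0) /\<^sub>R s - d)"
      unfolding eventually_at_filter
    proof (rule always_eventually, intro allI impI)
      fix s :: real assume "s \<noteq> 0"
      then have "(g s - g 0) /\<^sub>R s - d = (g s - g 0 - s *\<^sub>R d) /\<^sub>R s"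
        by (simp add: scaleR_diff_right)
      then show "norm (g s - g 0 - s *\<^sub>R d) / norm s = norm ((g s - g 0) /\<^sub>R s - d)"
        by (simp add: divide_inverse mult.commute)
    qed
  qed
  then show ?thesis by (simp add: LIM_zero_cancel)
qed

lemma finite_multi_indices: "finite (multi_indices k :: 'a::euclidean_space multiset set)"
proof (rule finite_subset)
  show "multi_indices k \<subseteq> mset ` {xs :: 'a list. set xs \<subseteq> Basis \<and> length xs \<le> k}"
  proof
    fix \<alpha> :: "'a multiset" assume "\<alpha> \<in> multi_indices k"
    moreover obtain xs where "mset xs = \<alpha>" using ex_mset by blast
    ultimately show "\<alpha> \<in> mset ` {xs. set xs \<subseteq> Basis \<and> length xs \<le> k}"
      by (auto simp: multi_indices_def intro!: image_eqI[of _ _ xs])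
  qed
  show "finite (mset ` {xs :: 'a list. set xs \<subseteq> Basis \<and> length xs \<le> k})"
    by (simp add: finite_lists_length_le)
qed

lemma pd_eqI: "(u has_derivative u') (at x) \<Longrightarrow> pd b u x = u' b"
proof -
  assume u: "(u has_derivative u') (at x)"
  have "((\<lambda>s. u (x + s *\<^sub>R b)) has_derivative (\<lambda>s. u' (s *\<^sub>R b))) (at 0)"
    by (rule has_derivative_compose[where g=u and g'=u'])
       (use u in \<open>auto intro!: derivative_eq_intros\<close>)
  then have "((\<lambda>s. u (x + s *\<^sub>R b)) has_vector_derivative u' b) (at 0)"
    using has_derivative_bounded_linear[OF u]
    by (simp add: has_vector_derivative_def bounded_linear.linear linear_cmul)
  then show ?thesis
    unfolding pd_def by (rule vector_derivative_at)
qed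

lemma pd_has_vector_derivative:
  assumes "u differentiable (at (x + s *\<^sub>R b))"
  shows "((\<lambda>s. u (x + s *\<^sub>R b)) has_vector_derivative pd b u (x + s *\<^sub>R b)) (at s)"
proof -
  obtain u' where u: "(u has_derivative u') (at (x + s *\<^sub>R b))"
    using assms by (auto simp: differentiable_def)
  have "((\<lambda>s. u (x + s *\<^sub>R b)) has_derivative (\<lambda>h. u' (h *\<^sub>R b))) (at s)"
    by (rule has_derivative_compose[where g=u and g'=u'])
       (use u in \<open>auto intro!: derivative_eq_intros\<close>)
  then show ?thesis
    using has_derivative_bounded_linear[OF u] pd_eqI[OF u]
    by (simp add: has_vector_derivative_def bounded_linear.linear linear_cmul)
qed

section \<open>Integrals of compactly supported functions and their derivatives\<close>

lemma lborel_integral_translation: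
  fixes u :: "'a::euclidean_space \<Rightarrow> 'b::euclidean_space"
  assumes "u \<in> borel_measurable borel"
  shows "integral\<^sup>L lborel (\<lambda>x. u (x + a)) = integral\<^sup>L lborel u"
proof -
  have "integral\<^sup>L lborel u = integral\<^sup>L (distr lborel borel ((+) a)) u"
    by (simp add: lborel_distr_plus)
  also have "\<dots> = integral\<^sup>L lborel (\<lambda>x. u (a + x))"
    using assms by (subst integral_distr) auto
  finally show ?thesis by (simp add: add.commute)
qed

lemma integrable_compact_support:
  fixes u :: "'a::euclidean_space \<Rightarrow> 'b::euclidean_space"
  assumes "continuous_on UNIV u" and "compact S" and "\<And>x. x \<notin> S \<Longrightarrow> u x = 0"
  shows "integrable lborel u"
proof -
  have "integrable lborel (\<lambda>x. indicator S x *\<^sub>R u x)"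
    using assms by (intro borel_integrable_compact) (auto intro: continuous_on_subset)
  also have "(\<lambda>x. indicator S x *\<^sub>R u x) = u"
    using assms(3) by (auto simp: indicator_def)
  finally show ?thesis .
qed

text \<open>Translation invariance makes every difference quotient integrate to zero.\<close>

lemma integral_pd_compact_support:
  fixes u :: "'a::euclidean_space \<Rightarrow> 'b::euclidean_space"
  assumes diff: "\<And>x. u differentiable (at x)" and cont: "continuous_on UNIV (pd b u)"
    and S: "compact S" and supp: "\<And>x. x \<notin> S \<Longrightarrow> u x = 0"
  shows "integral\<^sup>L lborel (pd b u) = 0"
proof -
  have contu: "continuous_on UNIV u"
    using diff by (simp add: continuous_at_imp_continuous_on differentiable_imp_continuous_within)
  have [measurable]: "u \<in> borel_measurable borel" "pd b u \<in> borel_measurable borel"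
    using contu cont by (auto intro: borel_measurable_continuous_onI)
  obtain R where R: "\<And>x. x \<in> S \<Longrightarrow> norm x \<le> R"
    using compact_imp_bounded[OF S] by (auto simp: bounded_iff)
  \<comment> \<open>Step lengths are at most 1, so the quotient at \<open>x\<close> vanishes once
    \<open>norm x > R + norm b\<close>; for all other \<open>x\<close> the segment from
    \<open>x\<close> to the shifted point stays in \<open>B\<close>. This is where the factor 2
    comes from.\<close>
  define B where "B = cball (0::'a) (R + 2 * norm b)"
  have compact_B: "compact B" by (simp add: B_def)
  obtain L where L: "\<And>x. x \<in> B \<Longrightarrow> norm (pd b u x) \<le> L"
    using compact_imp_bounded[OF compact_continuous_image[OF continuous_on_subset[OF cont] compact_B]]
    by (auto simp: bounded_iff)
  define q where "q = (\<lambda>n x. (u (x + inverse (real (Suc n)) *\<^sub>R b) - u x) /\<^sub>R inverse (real (Suc n)))"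
  have [measurable]: "q n \<in> borel_measurable borel" for n
    unfolding q_def by measurable
  have intu: "integrable lborel (\<lambda>x. u (x + a))" for a
  proof (rule integrable_compact_support)
    show "continuous_on UNIV (\<lambda>x. u (x + a))"
      by (intro continuous_on_compose2[OF contu] continuous_intros) auto
    show "compact ((\<lambda>x. x - a) ` S)"
      by (rule compact_continuous_image[OF _ S]) (intro continuous_intros)
    show "u (x + a) = 0" if "x \<notin> (\<lambda>x. x - a) ` S" for x
      using that by (intro supp) force
  qed
  have int0: "integral\<^sup>L lborel (q n) = 0" for n
  proof -
    have "integral\<^sup>L lborel (q n) =
        (integral\<^sup>L lborel (\<lambda>x. u (x + inverse (real (Suc n)) *\<^sub>R b)) - integral\<^sup>L lborel u) /\<^sub>R inverse (real (Suc n))"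
      unfolding q_def using intu[of 0] intu[of "inverse (real (Suc n)) *\<^sub>R b"]
      by (subst integral_scaleR_right) (simp_all add: Bochner_Integration.integral_diff)
    also have "\<dots> = 0"
      by (simp add: lborel_integral_translation)
    finally show ?thesis .
  qed
  \<comment> \<open>Dominated convergence: the mean value inequality along the segment bounds each
    quotient by the maximum \<open>L\<close> of the derivative on \<open>B\<close>.\<close>
  have "(\<lambda>n. integral\<^sup>L lborel (q n)) \<longlonglongrightarrow> integral\<^sup>L lborel (pd b u)"
  proof (rule integral_dominated_convergence[where w = "\<lambda>x. indicator B x *\<^sub>R L"])
    show "integrable lborel (\<lambda>x. indicator B x *\<^sub>R L)"
      by (rule borel_integrable_compact[OF compact_B]) auto
    show "AE x in lborel. (\<lambda>n. q n x) \<longlonglongrightarrow> pd b u x"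
    proof (rule AE_I2)
      fix x
      have "((\<lambda>s. u (x + s *\<^sub>R b)) has_vector_derivative pd b u x) (at 0)"
        using pd_has_vector_derivative[of u x 0 b] diff by simp
      then have "((\<lambda>s. (u (x + s *\<^sub>R b) - u x) /\<^sub>R s) \<longlongrightarrow> pd b u x) (at 0)"
        using has_vector_derivative_quotient by fastforce
      moreover have "filterlim (\<lambda>n. inverse (real (Suc n))) (at 0) sequentially"
        unfolding filterlim_at using LIMSEQ_inverse_real_of_nat by auto
      ultimately show "(\<lambda>n. q n x) \<longlonglongrightarrow> pd b u x"
        unfolding q_def by (rule filterlim_compose)
    qed
    show "AE x in lborel. norm (q n x) \<le> indicator B x *\<^sub>R L" for n
    proof (rule AE_I2)
      fix x
      define h where "h = inverse (real (Suc n))"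
      have h: "0 < h" "h \<le> 1" by (auto simp: h_def divide_simps)
      show "norm (q n x) \<le> indicator B x *\<^sub>R L"
      proof (cases "norm x \<le> R + norm b")
        case True
        have "norm (u (x + h *\<^sub>R b) - u (x + 0 *\<^sub>R b)) \<le> L * norm (h - 0)"
        proof (rule differentiable_bound[of "{0..h}"])
          show "((\<lambda>s. u (x + s *\<^sub>R b)) has_derivative (\<lambda>r. r *\<^sub>R pd b u (x + s *\<^sub>R b))) (at s within {0..h})" for s
            using pd_has_vector_derivative[OF diff, where x=x and s=s and b=b]
            unfolding has_vector_derivative_def by (rule has_derivative_at_withinI)
          show "onorm (\<lambda>r. r *\<^sub>R pd b u (x + s *\<^sub>R b)) \<le> L" if s: "s \<in> {0..h}" for s
          proof -
            have "norm (x + s *\<^sub>R b) \<le> norm x + \<bar>s\<bar> * norm b"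
              by (metis norm_scaleR norm_triangle_ineq)
            also have "\<bar>s\<bar> * norm b \<le> 1 * norm b"
              using s h by (intro mult_right_mono) auto
            finally have "x + s *\<^sub>R b \<in> B" using True by (simp add: B_def)
            then show ?thesis
              using L by (intro onorm_le) (simp add: mult.commute[of L] mult_left_mono)
          qed
        qed (use h in auto)
        moreover have "norm (q n x) = norm (u (x + h *\<^sub>R b) - u x) / h"
          unfolding q_def h_def[symmetric] using h by (simp add: divide_inverse mult.commute)
        ultimately have "norm (q n x) \<le> L"
          using h by (simp add: pos_divide_le_eq)
        moreover have "x \<in> B" using True norm_ge_zero[of b] unfolding B_def mem_cball_0 by linarith
        ultimately show ?thesis by simp
      next
        case False
        have "norm x \<le> norm (x + h *\<^sub>R b) + norm (h *\<^sub>R b)"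
          by (metis add_diff_cancel_right' norm_triangle_ineq4)
        moreover have "norm (h *\<^sub>R b) \<le> norm b"
          using h by (simp add: mult_left_le_one_le)
        ultimately have "x + h *\<^sub>R b \<notin> S" "x \<notin> S"
          using False R[of "x + h *\<^sub>R b"] R[of x] norm_ge_zero[of b] by linarith+
        then have "q n x = 0" unfolding q_def h_def[symmetric] by (simp add: supp)
        moreover have "0 \<le> indicator B x *\<^sub>R L"
          using L[of x] norm_ge_zero[of "pd b u x"] by (auto simp: indicator_def simp del: norm_ge_zero)
        ultimately show ?thesis by simp
      qed
    qed
  qed auto
  then show ?thesis
    using int0 by (simp add: LIMSEQ_const_iff)
qed

text \<open>The product of \<phi> and \<open>w\<close> inherits compact support from \<phi>, so its
  derivative integrates to zero; the product rule splits that integral in two.\<close>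

lemma integral_pd_by_parts:
  fixes w :: "'a::euclidean_space \<Rightarrow> 'b::euclidean_space" and \<phi> :: "'a \<Rightarrow> real"
  assumes \<phi>: "\<And>x. \<phi> differentiable (at x)" "continuous_on UNIV (pd b \<phi>)"
    and w: "\<And>x. w differentiable (at x)" "continuous_on UNIV (pd b w)"
    and S: "compact S" and supp: "\<And>x. x \<notin> S \<Longrightarrow> \<phi> x = 0"
  shows "integral\<^sup>L lborel (\<lambda>x. pd b \<phi> x *\<^sub>R w x) = - integral\<^sup>L lborel (\<lambda>x. \<phi> x *\<^sub>R pd b w x)"
proof -
  have [continuous_intros]: "continuous_on UNIV w" "continuous_on UNIV \<phi>"
    using \<phi>(1) w(1) by (simp_all add: continuous_at_imp_continuous_on differentiable_imp_continuous_within)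
  note [continuous_intros] = \<phi>(2) w(2)
  have prod: "((\<lambda>x. \<phi> x *\<^sub>R w x) has_derivative
      (\<lambda>h. \<phi> x *\<^sub>R frechet_derivative w (at x) h + frechet_derivative \<phi> (at x) h *\<^sub>R w x)) (at x)" for x
    by (rule has_derivative_scaleR; rule frechet_derivative_works[THEN iffD1]; rule \<phi> w)
  have pd_eq: "pd b u x = frechet_derivative u (at x) b"
    if "u differentiable (at x)" for u :: "'a \<Rightarrow> 'c::real_normed_vector" and x
    by (rule pd_eqI, rule frechet_derivative_works[THEN iffD1], rule that)
  have pd_prod: "pd b (\<lambda>x. \<phi> x *\<^sub>R w x) = (\<lambda>x. \<phi> x *\<^sub>R pd b w x + pd b \<phi> x *\<^sub>R w x)"
    by (rule ext, subst pd_eqI[OF prod]) (simp add: pd_eq \<phi> w)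
  \<comment> \<open>The complement of the compact set is open, so near such a point \<phi> is
    constantly zero.\<close>
  have supp': "pd b \<phi> x = 0" if "x \<notin> S" for x
  proof -
    have "open (- S)" using compact_imp_closed[OF S] by auto
    have "(\<phi> has_derivative (\<lambda>_. 0)) (at x)"
      by (rule has_derivative_transform_within_open[where f="\<lambda>_. 0" and s="-S"]) (use that supp \<open>open (- S)\<close> in auto)
    then show ?thesis by (rule pd_eqI)
  qed
  have "integral\<^sup>L lborel (\<lambda>x. \<phi> x *\<^sub>R pd b w x + pd b \<phi> x *\<^sub>R w x) = 0"
    unfolding pd_prod[symmetric]
  proof (rule integral_pd_compact_support[OF _ _ S])
    show "(\<lambda>x. \<phi> x *\<^sub>R w x) differentiable (at x)" for x
      using prod by (auto simp: differentiable_def)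
    show "continuous_on UNIV (pd b (\<lambda>x. \<phi> x *\<^sub>R w x))"
      unfolding pd_prod by (intro continuous_intros)
  qed (simp add: supp)
  moreover have "integrable lborel (\<lambda>x. \<phi> x *\<^sub>R pd b w x)" "integrable lborel (\<lambda>x. pd b \<phi> x *\<^sub>R w x)"
    by (intro integrable_compact_support[OF _ S] continuous_intros; simp add: supp supp')+
  ultimately show ?thesis
    by (simp add: Bochner_Integration.integral_add add_eq_0_iff)
qed

section \<open>Weak derivatives of all orders\<close>

lemma pds_support:
  assumes "open (- S)" and "\<And>x. x \<notin> S \<Longrightarrow> \<phi> x = 0" and "x \<notin> S"
  shows "pds bs \<phi> x = 0"
  using assms(3)
proof (induction bs arbitrary: x)
  case Nil then show ?case using assms by (simp add: pds_def)
next
  case (Cons b bs)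
  have "(pds bs \<phi> has_derivative (\<lambda>_. 0)) (at x)"
    by (rule has_derivative_transform_within_open[where f="\<lambda>_. 0" and s="-S"])
       (use Cons assms(1) in auto)
  then show ?case by (simp add: pds_def pd_eqI[of "foldr pd bs \<phi>"])
qed

lemma test_function_differentiable:
  "test_function U \<phi> \<Longrightarrow> set bs \<subseteq> Basis \<Longrightarrow> pds bs \<phi> differentiable_on UNIV"
  unfolding test_function_def lists_eq_set by blast

text \<open>\<open>W \<alpha>\<close> plays the role of the derivative of \<open>W {#}\<close> with
  multi-index \<alpha>. Indexing by multisets builds in that the order of differentiation is
  irrelevant, matching the indexing of weak derivatives.\<close>

definition smooth_family :: "('a::euclidean_space multiset \<Rightarrow> 'a \<Rightarrow> 'b::euclidean_space) \<Rightarrow> bool" where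
  "smooth_family W \<longleftrightarrow>
     (\<forall>\<alpha> x. W \<alpha> differentiable (at x)) \<and> (\<forall>\<alpha>. \<forall>b\<in>Basis. pd b (W \<alpha>) = W (add_mset b \<alpha>))"

lemma smooth_family_continuous: "smooth_family W \<Longrightarrow> continuous_on UNIV (W \<alpha>)"
  by (simp add: smooth_family_def continuous_at_imp_continuous_on differentiable_imp_continuous_within)

text \<open>Each integration by parts moves the outermost derivative from \<phi> into the index of
  \<open>W\<close>. The index \<beta> collects what has been moved, so it has to vary in the
  induction.\<close>

lemma integral_pds_by_parts:
  fixes W :: "'a::euclidean_space multiset \<Rightarrow> 'a \<Rightarrow> 'b::euclidean_space"
  assumes W: "smooth_family W" and \<phi>: "test_function U \<phi>" and bs: "set bs \<subseteq> Basis"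
  shows "integral\<^sup>L lborel (\<lambda>x. pds bs \<phi> x *\<^sub>R W \<beta> x)
       = (-1) ^ length bs *\<^sub>R integral\<^sup>L lborel (\<lambda>x. \<phi> x *\<^sub>R W (mset bs + \<beta>) x)"
  using bs
proof (induction bs arbitrary: \<beta>)
  case Nil then show ?case by (simp add: pds_def)
next
  case (Cons b bs)
  let ?S = "closure {x. \<phi> x \<noteq> 0}"
  have diff: "pds cs \<phi> differentiable (at x)" if "set cs \<subseteq> Basis" for cs x
    using test_function_differentiable[OF \<phi> that] by (simp add: differentiable_on_def)
  have cont: "continuous_on UNIV (pds cs \<phi>)" if "set cs \<subseteq> Basis" for cs
    using diff[OF that] by (simp add: continuous_at_imp_continuous_on differentiable_imp_continuous_within)
  have b: "b \<in> Basis" "set bs \<subseteq> Basis" using Cons.prems by auto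
  have pds_Cons: "pds (b # bs) \<phi> = pd b (pds bs \<phi>)" by (simp add: pds_def)
  have pdW: "pd b (W \<beta>) = W (add_mset b \<beta>)" using W b by (simp add: smooth_family_def)
  have zero: "\<phi> x = 0" if "x \<notin> ?S" for x
    using that closure_subset[of "{x. \<phi> x \<noteq> 0}"] by blast
  have supp: "pds bs \<phi> x = 0" if "x \<notin> ?S" for x
    by (rule pds_support[OF open_Compl[OF closed_closure] zero that])
  have "integral\<^sup>L lborel (\<lambda>x. pds (b # bs) \<phi> x *\<^sub>R W \<beta> x)
      = - integral\<^sup>L lborel (\<lambda>x. pds bs \<phi> x *\<^sub>R W (add_mset b \<beta>) x)"
    unfolding pds_Cons pdW[symmetric]
  proof (rule integral_pd_by_parts[of _ _ _ ?S])
    show "continuous_on UNIV (pd b (pds bs \<phi>))"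
      unfolding pds_Cons[symmetric] using Cons.prems by (rule cont)
    show "continuous_on UNIV (pd b (W \<beta>))"
      unfolding pdW using W by (rule smooth_family_continuous)
    show "compact ?S" using \<phi> unfolding test_function_def by blast
    show "pds bs \<phi> differentiable (at x)" for x by (rule diff[OF b(2)])
    show "W \<beta> differentiable (at x)" for x using W by (simp add: smooth_family_def)
  qed (rule supp)
  also have "\<dots> = (-1) ^ length (b # bs) *\<^sub>R integral\<^sup>L lborel (\<lambda>x. \<phi> x *\<^sub>R W (mset (b # bs) + \<beta>) x)"
    using Cons.IH[OF b(2)] by simp
  finally show ?case .
qed

text \<open>Only the values on \<open>U\<close> are tied to the family. This suffices because test
  functions and their derivatives vanish off \<open>U\<close>, so the integrals over
  \<open>U\<close> are whole-space integrals of the family.\<close>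

lemma smooth_family_weak_derivative:
  fixes W :: "'a::euclidean_space multiset \<Rightarrow> 'a \<Rightarrow> 'b::euclidean_space"
  assumes W: "smooth_family W" and \<alpha>: "set_mset \<alpha> \<subseteq> Basis"
    and u: "\<And>x. x \<in> U \<Longrightarrow> u x = W {#} x" and w: "\<And>x. x \<in> U \<Longrightarrow> w x = W \<alpha> x"
  shows "weak_derivative U \<alpha> u w"
  unfolding weak_derivative_def
proof (intro allI impI)
  fix \<phi> bs assume \<phi>: "test_function U \<phi>" and bs: "mset bs = \<alpha>"
  let ?S = "closure {x. \<phi> x \<noteq> 0}"
  have SU: "?S \<subseteq> U" using \<phi> unfolding test_function_def by blast
  have setbs: "set bs \<subseteq> Basis" using bs \<alpha> by auto
  have zero: "\<phi> x = 0" if "x \<notin> ?S" for x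
    using that closure_subset[of "{x. \<phi> x \<noteq> 0}"] by blast
  have supp: "pds cs \<phi> x = 0" if "x \<notin> U" for x cs
    by (rule pds_support[of ?S]) (use that SU in \<open>auto intro: zero\<close>)
  have [measurable]: "pds cs \<phi> \<in> borel_measurable borel" if "set cs \<subseteq> Basis" for cs
    by (intro borel_measurable_continuous_onI differentiable_imp_continuous_on
        test_function_differentiable[OF \<phi> that])
  have [measurable]: "W \<beta> \<in> borel_measurable borel" for \<beta>
    by (intro borel_measurable_continuous_onI smooth_family_continuous W)
  \<comment> \<open>Removes the restriction to \<open>U\<close> and passes from Lebesgue to Borel
    measurability in one go; used once for \<open>u\<close> with the derivatives of \<phi> and once
    for \<open>w\<close> with \<phi> itself.\<close>
  have eq: "(LINT x:U|lebesgue. pds cs \<phi> x *\<^sub>R v x) = integral\<^sup>L lborel (\<lambda>x. pds cs \<phi> x *\<^sub>R W \<beta> x)"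
    if cs: "set cs \<subseteq> Basis" and v: "\<And>x. x \<in> U \<Longrightarrow> v x = W \<beta> x" for cs v \<beta>
  proof -
    have "(\<lambda>x. indicator U x *\<^sub>R (pds cs \<phi> x *\<^sub>R v x)) = (\<lambda>x. pds cs \<phi> x *\<^sub>R W \<beta> x)"
      using v supp by (auto simp: indicator_def)
    then show ?thesis
      using cs by (simp add: set_lebesgue_integral_def integral_completion)
  qed
  have "(LINT x:U|lebesgue. pds bs \<phi> x *\<^sub>R u x) = integral\<^sup>L lborel (\<lambda>x. pds bs \<phi> x *\<^sub>R W {#} x)"
    using setbs u by (rule eq)
  also have "\<dots> = (-1) ^ length bs *\<^sub>R integral\<^sup>L lborel (\<lambda>x. \<phi> x *\<^sub>R W \<alpha> x)"
    using integral_pds_by_parts[OF W \<phi> setbs, of "{#}"] bs by simp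
  also have "integral\<^sup>L lborel (\<lambda>x. \<phi> x *\<^sub>R W \<alpha> x) = (LINT x:U|lebesgue. \<phi> x *\<^sub>R w x)"
    using eq[of "[]" w \<alpha>] w by (simp add: pds_def)
  finally show "(LINT x:U|lebesgue. pds bs \<phi> x *\<^sub>R u x)
      = (-1) ^ size \<alpha> *\<^sub>R (LINT x:U|lebesgue. \<phi> x *\<^sub>R w x)"
    using bs by auto
qed

section \<open>Sobolev norms of functions of a complex phase\<close>

text \<open>An explicit sequence of successive derivatives, so that powers of the frequency can be
  written into its members.\<close>

definition derivative_chain :: "(nat \<Rightarrow> complex \<Rightarrow> complex) \<Rightarrow> bool" where
  "derivative_chain \<psi> \<longleftrightarrow> (\<forall>m z. (\<psi> m has_field_derivative \<psi> (Suc m) z) (at z))"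

text \<open>The factor that the chain rule produces when \<open>\<psi> (L x + z0)\<close> is
  differentiated along \<alpha>, as for Fourier symbols.\<close>

definition symbol :: "('a \<Rightarrow> complex) \<Rightarrow> 'a multiset \<Rightarrow> complex" where
  "symbol L \<alpha> = prod_mset (image_mset L \<alpha>)"

lemma has_derivative_profile:
  assumes \<psi>: "derivative_chain \<psi>" and R: "bounded_linear R" and L: "bounded_linear L"
  shows "((\<lambda>x. R (a * \<psi> m (L x + z0))) has_derivative (\<lambda>h. R (a * (L h * \<psi> (Suc m) (L x + z0))))) (at x)"
proof -
  have L': "((\<lambda>x. L x + z0) has_derivative L) (at x)"
    using bounded_linear_imp_has_derivative[OF L] by (auto intro!: derivative_eq_intros)
  have "(\<psi> m has_derivative (*) (\<psi> (Suc m) (L x + z0))) (at (L x + z0))"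
    using \<psi> by (simp add: derivative_chain_def has_field_derivative_def)
  from has_derivative_compose[OF L' this]
  have "((\<lambda>x. a * \<psi> m (L x + z0)) has_derivative (\<lambda>h. a * (L h * \<psi> (Suc m) (L x + z0)))) (at x)"
    by (auto intro!: derivative_eq_intros simp: mult.commute)
  then show ?thesis
    by (rule bounded_linear.has_derivative[OF R])
qed

lemma smooth_family_profile:
  fixes L :: "'a::euclidean_space \<Rightarrow> complex" and R :: "complex \<Rightarrow> 'b::euclidean_space"
  assumes "derivative_chain \<psi>" and "bounded_linear R" and "bounded_linear L"
  shows "smooth_family (\<lambda>\<alpha> x. R (symbol L \<alpha> * \<psi> (size \<alpha>) (L x + z0)))"
  unfolding smooth_family_def
proof (intro conjI allI ballI)
  show "(\<lambda>x. R (symbol L \<alpha> * \<psi> (size \<alpha>) (L x + z0))) differentiable (at x)" for \<alpha> x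
    unfolding differentiable_def by (rule exI, rule has_derivative_profile[OF assms])
  show "pd b (\<lambda>x. R (symbol L \<alpha> * \<psi> (size \<alpha>) (L x + z0)))
      = (\<lambda>x. R (symbol L (add_mset b \<alpha>) * \<psi> (size (add_mset b \<alpha>)) (L x + z0)))" for b \<alpha>
    by (rule ext, subst pd_eqI[OF has_derivative_profile[OF assms]]) (simp add: symbol_def ac_simps)
qed

text \<open>Collects everything in the Sobolev bound that does not involve the profile \<psi>. It is
  therefore the same for all members of the sequence of solutions.\<close>

definition profile_const ::
    "'a::euclidean_space set \<Rightarrow> nat \<Rightarrow> (complex \<Rightarrow> 'b::euclidean_space) \<Rightarrow> ('a \<Rightarrow> complex) \<Rightarrow> ('a \<Rightarrow> real) \<Rightarrow> real" where
  "profile_const U k R L g =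
     sqrt (\<Sum>\<alpha>\<in>multi_indices k. (onorm R * norm (symbol L \<alpha>))\<^sup>2 * (LINT x:U|lebesgue. g x))"

lemma weak_jet_bound:
  fixes u :: "'a::euclidean_space \<Rightarrow> 'b::euclidean_space"
  assumes "weak_jet U k u W"
  shows "(LINT x:U|lebesgue. (norm (u x))\<^sup>2) \<le> (\<Sum>\<alpha>\<in>multi_indices k. LINT x:U|lebesgue. (norm (W \<alpha> x))\<^sup>2)"
proof -
  have "(LINT x:U|lebesgue. (norm (W {#} x))\<^sup>2) \<le> (\<Sum>\<alpha>\<in>multi_indices k. LINT x:U|lebesgue. (norm (W \<alpha> x))\<^sup>2)"
    by (rule member_le_sum[OF _ _ finite_multi_indices])
       (auto simp: multi_indices_def set_lebesgue_integral_def)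
  then show ?thesis using assms by (simp add: weak_jet_def)
qed

text \<open>The infimum lies below the sum of any single jet, and above the order-zero term, which
  all jets of \<open>u\<close> share.\<close>

lemma sobolev_norm_bounds:
  fixes u :: "'a::euclidean_space \<Rightarrow> 'b::euclidean_space"
  assumes "weak_jet U k u W"
  shows sobolev_norm_ge_L2: "sqrt (LINT x:U|lebesgue. (norm (u x))\<^sup>2) \<le> sobolev_norm U k u"
    and sobolev_norm_le: "sobolev_norm U k u \<le> sqrt (\<Sum>\<alpha>\<in>multi_indices k. LINT x:U|lebesgue. (norm (W \<alpha> x))\<^sup>2)"
    and sobolev_norm_nonneg: "0 \<le> sobolev_norm U k u"
proof -
  show L2: "sqrt (LINT x:U|lebesgue. (norm (u x))\<^sup>2) \<le> sobolev_norm U k u"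
    unfolding sobolev_norm_def
    using assms by (intro real_sqrt_le_mono cINF_greatest) (auto intro: weak_jet_bound)
  show "0 \<le> sobolev_norm U k u"
    by (rule order_trans[OF _ L2]) (simp add: set_lebesgue_integral_def)
  show "sobolev_norm U k u \<le> sqrt (\<Sum>\<alpha>\<in>multi_indices k. LINT x:U|lebesgue. (norm (W \<alpha> x))\<^sup>2)"
    unfolding sobolev_norm_def
  proof (intro real_sqrt_le_mono cINF_lower)
    show "bdd_below ((\<lambda>W. \<Sum>\<alpha>\<in>multi_indices k. LINT x:U|lebesgue. (norm (W \<alpha> x))\<^sup>2) ` {W. weak_jet U k u W})"
      by (intro bdd_belowI2[of _ 0] sum_nonneg) (simp add: set_lebesgue_integral_def)
  qed (use assms in simp)
qed

text \<open>The classical derivatives serve as weak ones. A single majorant, \<open>g\<close> times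
  the square of \<open>B\<close>, controls all orders up to \<open>k\<close>, giving both square
  integrability and the norm bound.\<close>

lemma profile_weak_jet:
  fixes L :: "'a::euclidean_space \<Rightarrow> complex" and R :: "complex \<Rightarrow> 'b::euclidean_space"
  assumes chain: "derivative_chain \<psi>" and R: "bounded_linear R" and L: "bounded_linear L"
    and U: "open U" and u: "\<And>x. x \<in> U \<Longrightarrow> u x = R (\<psi> 0 (L x + z0))"
    and g: "set_integrable lebesgue U g"
    and B: "0 \<le> B" "\<And>m x. m \<le> k \<Longrightarrow> x \<in> U \<Longrightarrow> (norm (\<psi> m (L x + z0)))\<^sup>2 \<le> B\<^sup>2 * g x"
  obtains W where "weak_jet U k u W"
    and "sqrt (\<Sum>\<alpha>\<in>multi_indices k. LINT x:U|lebesgue. (norm (W \<alpha> x))\<^sup>2) \<le> B * profile_const U k R L g"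
proof -
  define V where "V = (\<lambda>\<alpha> x. R (symbol L \<alpha> * \<psi> (size \<alpha>) (L x + z0)))"
  \<comment> \<open>A jet must have \<open>u\<close> itself as its entry at \<open>{#}\<close>,
    whereas \<open>u\<close> follows the profile only on \<open>U\<close>; hence the replaced
    entry.\<close>
  define W where "W = V({#} := u)"
  have V: "smooth_family V"
    unfolding V_def using chain R L by (rule smooth_family_profile)
  have WV: "W \<alpha> x = V \<alpha> x" if "x \<in> U" for \<alpha> x
    using u[OF that] by (simp add: W_def V_def symbol_def)
  have [measurable]: "V \<alpha> \<in> borel_measurable borel" for \<alpha>
    by (intro borel_measurable_continuous_onI smooth_family_continuous V)
  have [measurable]: "U \<in> sets borel" using U by simp
  have ind: "(\<lambda>x. indicator U x *\<^sub>R W \<alpha> x) = (\<lambda>x. indicator U x *\<^sub>R V \<alpha> x)" for \<alpha>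
    by (rule ext) (auto simp: indicator_def WV)
  have ind2: "(\<lambda>x. indicator U x *\<^sub>R (norm (W \<alpha> x))\<^sup>2) = (\<lambda>x. indicator U x *\<^sub>R (norm (V \<alpha> x))\<^sup>2)" for \<alpha>
    using WV by (auto simp: indicator_def)
  have meas: "set_borel_measurable lebesgue U (W \<alpha>)" for \<alpha>
    unfolding set_borel_measurable_def ind by (rule measurable_completion) measurable
  have bound: "(norm (W \<alpha> x))\<^sup>2 \<le> B\<^sup>2 * ((onorm R * norm (symbol L \<alpha>))\<^sup>2 * g x)"
    if "\<alpha> \<in> multi_indices k" "x \<in> U" for \<alpha> x
  proof -
    have "norm (V \<alpha> x) \<le> onorm R * norm (symbol L \<alpha>) * norm (\<psi> (size \<alpha>) (L x + z0))"
      using onorm[OF R, of "symbol L \<alpha> * \<psi> (size \<alpha>) (L x + z0)"] by (simp add: V_def norm_mult mult.assoc)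
    then have "(norm (V \<alpha> x))\<^sup>2 \<le> (onorm R * norm (symbol L \<alpha>))\<^sup>2 * (norm (\<psi> (size \<alpha>) (L x + z0)))\<^sup>2"
      by (metis norm_ge_zero power_mono power_mult_distrib)
    also have "\<dots> \<le> (onorm R * norm (symbol L \<alpha>))\<^sup>2 * (B\<^sup>2 * g x)"
      using that by (intro mult_left_mono B) (auto simp: multi_indices_def)
    finally show ?thesis using that by (simp add: WV ac_simps)
  qed
  have int: "set_integrable lebesgue U (\<lambda>x. B\<^sup>2 * ((onorm R * norm (symbol L \<alpha>))\<^sup>2 * g x))" for \<alpha>
    using g by (intro set_integrable_mult_right) auto
  have intW: "set_integrable lebesgue U (\<lambda>x. (norm (W \<alpha> x))\<^sup>2)" if "\<alpha> \<in> multi_indices k" for \<alpha>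
    unfolding set_integrable_def
  proof (rule Bochner_Integration.integrable_bound[OF int[of \<alpha>, unfolded set_integrable_def]])
    show "(\<lambda>x. indicator U x *\<^sub>R (norm (W \<alpha> x))\<^sup>2) \<in> borel_measurable lebesgue"
      unfolding ind2 by (rule measurable_completion) measurable
    show "AE x in lebesgue. norm (indicator U x *\<^sub>R (norm (W \<alpha> x))\<^sup>2)
        \<le> norm (indicator U x *\<^sub>R (B\<^sup>2 * ((onorm R * norm (symbol L \<alpha>))\<^sup>2 * g x)))"
      using bound[OF that] by (intro AE_I2) (auto simp: indicator_def intro: order_trans[OF _ abs_ge_self])
  qed
  have "weak_jet U k u W"
    unfolding weak_jet_def square_integrable_on_def
  proof (intro conjI ballI)
    show "W {#} = u" by (simp add: W_def)
    show "weak_derivative U \<alpha> u (W \<alpha>)" if "\<alpha> \<in> multi_indices k" for \<alpha>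
      by (rule smooth_family_weak_derivative[OF V])
         (use that WV[of _ "{#}"] WV in \<open>auto simp: multi_indices_def W_def\<close>)
  qed (use meas intW in auto)
  moreover have "(\<Sum>\<alpha>\<in>multi_indices k. LINT x:U|lebesgue. (norm (W \<alpha> x))\<^sup>2)
      \<le> (\<Sum>\<alpha>\<in>multi_indices k. B\<^sup>2 * ((onorm R * norm (symbol L \<alpha>))\<^sup>2 * (LINT x:U|lebesgue. g x)))"
  proof (rule sum_mono)
    fix \<alpha> :: "'a multiset" assume \<alpha>: "\<alpha> \<in> multi_indices k"
    have "(LINT x:U|lebesgue. (norm (W \<alpha> x))\<^sup>2) \<le> (LINT x:U|lebesgue. B\<^sup>2 * ((onorm R * norm (symbol L \<alpha>))\<^sup>2 * g x))"
      using bound[OF \<alpha>] by (intro set_integral_mono intW[OF \<alpha>] int)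
    then show "(LINT x:U|lebesgue. (norm (W \<alpha> x))\<^sup>2) \<le> B\<^sup>2 * ((onorm R * norm (symbol L \<alpha>))\<^sup>2 * (LINT x:U|lebesgue. g x))"
      by simp
  qed
  then have "sqrt (\<Sum>\<alpha>\<in>multi_indices k. LINT x:U|lebesgue. (norm (W \<alpha> x))\<^sup>2) \<le> B * profile_const U k R L g"
    using B(1) unfolding profile_const_def sum_distrib_left[symmetric]
    by (metis real_sqrt_le_mono real_sqrt_mult real_sqrt_abs abs_of_nonneg)
  ultimately show ?thesis by (rule that)
qed

lemma profile_sobolev:
  fixes L :: "'a::euclidean_space \<Rightarrow> complex" and R :: "complex \<Rightarrow> 'b::euclidean_space"
  assumes chain: "derivative_chain \<psi>" and R: "bounded_linear R" and L: "bounded_linear L"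
    and U: "open U" and u: "\<And>x. x \<in> U \<Longrightarrow> u x = R (\<psi> 0 (L x + z0))"
    and g: "set_integrable lebesgue U g"
    and B: "0 \<le> B" "\<And>m x. m \<le> k \<Longrightarrow> x \<in> U \<Longrightarrow> (norm (\<psi> m (L x + z0)))\<^sup>2 \<le> B\<^sup>2 * g x"
  shows "u \<in> sobolev U k" and "0 \<le> sobolev_norm U k u"
    and "sobolev_norm U k u \<le> B * profile_const U k R L g"
    and "sqrt (LINT x:U|lebesgue. (norm (u x))\<^sup>2) \<le> sobolev_norm U k u"
proof -
  obtain W where W: "weak_jet U k u W"
      "sqrt (\<Sum>\<alpha>\<in>multi_indices k. LINT x:U|lebesgue. (norm (W \<alpha> x))\<^sup>2) \<le> B * profile_const U k R L g"
    by (rule profile_weak_jet[OF assms])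
  show "u \<in> sobolev U k" using W(1) by (auto simp: sobolev_def)
  show "0 \<le> sobolev_norm U k u" using W(1) by (rule sobolev_norm_nonneg)
  show "sobolev_norm U k u \<le> B * profile_const U k R L g"
    using sobolev_norm_le[OF W(1)] W(2) by simp
  show "sqrt (LINT x:U|lebesgue. (norm (u x))\<^sup>2) \<le> sobolev_norm U k u"
    using W(1) by (rule sobolev_norm_ge_L2)
qed

section \<open>The wave packet\<close>

lemma integrable_inverse_1_plus_square_lborel: "integrable lborel (\<lambda>x::real. inverse (1 + x\<^sup>2))"
  using integrable_inverse_1_plus_square by (simp add: set_integrable_def)

lemma integrable_lebesgue_weight1: "integrable lebesgue (\<lambda>x::real. inverse (1 + x\<^sup>2))"
  using integrable_inverse_1_plus_square_lborel by (subst integrable_completion) auto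

lemma integrable_lebesgue_weight2:
  "integrable lebesgue (\<lambda>x::real \<times> real. inverse (1 + (fst x)\<^sup>2) * inverse (1 + (snd x)\<^sup>2))"
proof -
  let ?g = "\<lambda>x::real. inverse (1 + x\<^sup>2)"
  have "integrable (lborel \<Otimes>\<^sub>M lborel) (\<lambda>x::real \<times> real. ?g (fst x) * ?g (snd x))"
  proof (rule lborel_pair.Fubini_integrable)
    show "integrable lborel (\<lambda>x. \<integral> y. norm (?g (fst (x, y)) * ?g (snd (x, y))) \<partial>lborel)"
      using integrable_inverse_1_plus_square_lborel by (simp add: abs_mult)
    show "AE x in lborel. integrable lborel (\<lambda>y. ?g (fst (x, y)) * ?g (snd (x, y)))"
      using integrable_inverse_1_plus_square_lborel by simp
  qed measurable
  then show ?thesis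
    by (subst integrable_completion) (simp_all add: lborel_prod borel_prod)
qed

text \<open>\<open>packet z\<close> is the integral of \<open>exp (\<i> \<xi> z)\<close> over \<open>\<xi> \<in> [1, 2]\<close>.\<close>

definition packet :: "complex \<Rightarrow> complex" where
  "packet z = (if z = 0 then 1 else (exp (2 * \<i> * z) - exp (\<i> * z)) / (\<i> * z))"

text \<open>The singularity at 0 is removable: the numerator divided by \<i> vanishes there with
  derivative 1, which is the value chosen for \<open>packet 0\<close>.\<close>

lemma packet_holomorphic: "packet holomorphic_on UNIV"
proof (rule pole_theorem_open_0[where a=0])
  show "(\<lambda>z. (exp (2 * \<i> * z) - exp (\<i> * z)) / \<i>) holomorphic_on UNIV"
    by (intro holomorphic_intros) auto
  have "((\<lambda>z. (exp (2 * \<i> * z) - exp (\<i> * z)) / \<i>) has_field_derivative 1) (at 0)"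
    by (auto intro!: derivative_eq_intros)
  then show "packet 0 = deriv (\<lambda>z. (exp (2 * \<i> * z) - exp (\<i> * z)) / \<i>) 0"
    by (simp add: DERIV_imp_deriv packet_def)
qed (auto simp: packet_def)

lemma norm_exp_ii: "norm (exp (\<i> * of_real r * z)) = exp (- r * Im z)"
  by (simp add: norm_exp_eq_Re)

text \<open>Two bounds are added. The triangle inequality on the closed form gives the gain of
  \<open>1 / norm z\<close> far out; near 0 the packet is an average of exponentials with
  frequencies in [1, 2].\<close>

lemma packet_norm: "norm (packet z) * (1 + norm z) \<le> 2 * (exp (- Im z) + exp (- 2 * Im z))"
proof (cases "z = 0")
  case True then show ?thesis by (simp add: packet_def)
next
  case False
  define E where "E = exp (- Im z) + exp (- 2 * Im z)"
  have e1: "norm (exp (\<i> * z)) = exp (- Im z)" and e2: "norm (exp (2 * \<i> * z)) = exp (- 2 * Im z)"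
    by (simp_all add: norm_exp_eq_Re)
  have "norm (packet z) * norm z = norm (exp (2 * \<i> * z) - exp (\<i> * z))"
    using False by (simp add: packet_def norm_divide norm_mult)
  also have "\<dots> \<le> E"
    using norm_triangle_ineq4[of "exp (2 * \<i> * z)" "exp (\<i> * z)"] e1 e2 by (simp add: E_def)
  finally have far: "norm (packet z) * norm z \<le> E" .
  let ?p = "\<lambda>r::real. exp (\<i> * of_real r * z) / (\<i> * z)"
  \<comment> \<open>The packet is the increment of \<open>?p\<close> over [1, 2]. \<open>E\<close>
    dominates the modulus of its derivative for either sign of \<open>Im z\<close>, since the larger
    of the two endpoint exponentials does.\<close>
  have "norm (?p 2 - ?p 1) \<le> E * norm (2 - 1 :: real)"
  proof (rule differentiable_bound[of "{1..2}"])
    fix r :: real assume r: "r \<in> {1..2}"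
    have "(?p has_vector_derivative exp (\<i> * of_real r * z)) (at r within {1..2})"
      using False by (auto intro!: derivative_eq_intros has_vector_derivative_real_field simp: field_simps)
    then show "(?p has_derivative (\<lambda>h. h *\<^sub>R exp (\<i> * of_real r * z))) (at r within {1..2})"
      by (simp add: has_vector_derivative_def)
    have "exp (- r * Im z) \<le> E"
    proof (cases "0 \<le> Im z")
      case True
      then have "- r * Im z \<le> - Im z" using r mult_right_mono[of 1 r "Im z"] by simp
      then show ?thesis by (simp add: E_def add_increasing2)
    next
      case False
      then have "- r * Im z \<le> - 2 * Im z" using r by (simp add: mult_right_mono_neg)
      then show ?thesis by (simp add: E_def add_increasing)
    qed
    then show "onorm (\<lambda>h. h *\<^sub>R exp (\<i> * of_real r * z)) \<le> E"
      by (intro onorm_le) (simp add: norm_exp_ii mult.commute[of E] mult_left_mono)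
  qed auto
  moreover have "?p 2 - ?p 1 = packet z"
    using False by (simp add: packet_def diff_divide_distrib mult.commute)
  ultimately have "norm (packet z) \<le> E" by simp
  with far have "norm (packet z) + norm (packet z) * norm z \<le> 2 * E" by linarith
  then show ?thesis by (simp add: E_def distrib_left)
qed

text \<open>Cauchy's estimate on the unit circle about \<open>z\<close>: there the imaginary part
  drops by at most 1, costing at most \<open>exp 2\<close>, and \<open>1 + norm z\<close> exceeds
  \<open>1 + norm w\<close> by at most a factor 2.\<close>

lemma packet_deriv_norm:
  "norm ((deriv ^^ m) packet z) \<le> 4 * exp 2 * fact m * (exp (- Im z) + exp (- 2 * Im z)) / (1 + norm z)"
proof -
  have "norm ((deriv ^^ m) packet z)
      \<le> fact m * (4 * exp 2 * (exp (- Im z) + exp (- 2 * Im z)) / (1 + norm z)) / 1 ^ m"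
  proof (rule Cauchy_inequality)
    show "packet holomorphic_on ball z 1"
      using packet_holomorphic by (rule holomorphic_on_subset) simp
    show "continuous_on (cball z 1) packet"
      using holomorphic_on_imp_continuous_on[OF packet_holomorphic] by (rule continuous_on_subset) simp
    fix w assume w: "norm (z - w) = 1"
    have Im: "Im z - 1 \<le> Im w"
      using abs_Im_le_cmod[of "z - w"] w by simp
    have nz: "1 + norm z \<le> 2 * (1 + norm w)"
    proof -
      have "norm z \<le> 1 + norm w" using norm_triangle_ineq2[of z w] w by simp
      also have "\<dots> \<le> 1 + 2 * norm w" by simp
      finally show ?thesis by simp
    qed
    have "norm (packet w) * (1 + norm z) \<le> 2 * (norm (packet w) * (1 + norm w))"
      using mult_left_mono[OF nz, of "norm (packet w)"] by (simp add: algebra_simps)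
    also have "\<dots> \<le> 2 * (2 * (exp (- Im w) + exp (- 2 * Im w)))"
      by (intro mult_left_mono packet_norm) auto
    also have "\<dots> \<le> 2 * (2 * (exp (2 - Im z) + exp (2 - 2 * Im z)))"
      using Im by (intro mult_left_mono add_mono) auto
    also have "\<dots> = 4 * exp 2 * (exp (- Im z) + exp (- 2 * Im z))"
      by (simp add: exp_diff exp_minus field_simps)
    finally show "norm (packet w) \<le> 4 * exp 2 * (exp (- Im z) + exp (- 2 * Im z)) / (1 + norm z)"
      by (simp add: pos_le_divide_eq add_pos_nonneg)
  qed auto
  then show ?thesis by (simp add: ac_simps)
qed

text \<open>By the mean value theorem the real part equals \<open>exp (r * Y) * cos (r * x)\<close>
  for some \<open>r\<close> in (1, 2). There \<open>r * x\<close> has modulus at most 1, hence below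
  \<open>pi / 3\<close>, so the cosine is at least 1/2.\<close>

lemma packet_lower:
  assumes Y: "0 < Y" and x: "\<bar>x\<bar> \<le> 1 / 2"
  shows "exp Y / 2 \<le> Re (packet (of_real x - \<i> * of_real Y))"
proof -
  define z where "z = of_real x - \<i> * of_real Y"
  have z: "Re z = x" "Im z = - Y" "z \<noteq> 0" using Y by (auto simp: z_def complex_eq_iff)
  let ?p = "\<lambda>r::real. Re (exp (\<i> * of_real r * z) / (\<i> * z))"
  have deriv: "DERIV ?p r :> Re (exp (\<i> * of_real r * z))" for r
  proof -
    have "((\<lambda>r::real. exp (\<i> * of_real r * z) / (\<i> * z)) has_vector_derivative exp (\<i> * of_real r * z)) (at r)"
      using z by (auto intro!: derivative_eq_intros has_vector_derivative_real_field simp: field_simps)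
    from has_derivative_Re[OF this[unfolded has_vector_derivative_def]]
    show ?thesis by (simp add: has_field_derivative_def mult_commute_abs)
  qed
  have "\<exists>r>1. r < 2 \<and> ?p 2 - ?p 1 = (2 - 1) * Re (exp (\<i> * of_real r * z))"
    by (rule MVT2) (simp, rule deriv)
  then obtain r where r: "1 < r" "r < 2" "?p 2 - ?p 1 = (2 - 1) * Re (exp (\<i> * of_real r * z))"
    by blast
  have "Re (exp (\<i> * of_real r * z)) = exp (r * Y) * cos (r * x)"
    by (simp add: Re_exp z)
  moreover have "Re (packet z) = ?p 2 - ?p 1"
    using z by (simp add: packet_def diff_divide_distrib mult.commute)
  moreover have "exp Y * (1 / 2) \<le> exp (r * Y) * cos (r * x)"
  proof (rule mult_mono)
    show "exp Y \<le> exp (r * Y)" using r Y by simp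
    have "\<bar>r * x\<bar> \<le> 2 * (1 / 2)" unfolding abs_mult using r x by (intro mult_mono) auto
    then have "\<bar>r * x\<bar> \<le> pi / 3" using pi_gt3 by simp
    then have "cos (pi / 3) \<le> cos \<bar>r * x\<bar>" by (intro cos_monotone_0_pi_le) auto
    then show "1 / 2 \<le> cos (r * x)" by (simp add: cos_60)
  qed auto
  ultimately show ?thesis using r(3) by (simp add: z_def)
qed

text \<open>The exponential records decay away from the interface, the denominator square
  integrability along it. The strip below the real axis of depth \<open>Y\<close> leaves room for
  the shift by \<open>lam * t\<close> that time evolution causes.\<close>

definition decays :: "(complex \<Rightarrow> complex) \<Rightarrow> real \<Rightarrow> real \<Rightarrow> bool" where
  "decays F Y C \<longleftrightarrow> (\<forall>z. - Y \<le> Im z \<longrightarrow> norm (F z) \<le> C * exp (- Im z) / (1 + norm z))"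

definition admissible :: "(nat \<Rightarrow> complex \<Rightarrow> complex) \<Rightarrow> bool" where
  "admissible \<psi> \<longleftrightarrow> derivative_chain \<psi> \<and> (\<forall>m Y. \<exists>C. decays (\<psi> m) Y C)"

lemma decays_mono: "decays F Y C \<Longrightarrow> C \<le> D \<Longrightarrow> decays F Y D"
  unfolding decays_def
  by (meson add_nonneg_nonneg divide_right_mono exp_ge_zero mult_right_mono norm_ge_zero order_trans zero_le_one)

lemma admissible_uniform:
  assumes "admissible \<psi>"
  shows "\<exists>C\<ge>0. \<forall>m\<le>k. decays (\<psi> m) Y C"
proof -
  obtain C where C: "\<And>m. decays (\<psi> m) Y (C m)"
    using choice[of "\<lambda>m C. decays (\<psi> m) Y C"] assms unfolding admissible_def by blast
  have "decays (\<psi> m) Y (\<Sum>m\<le>k. \<bar>C m\<bar>)" if "m \<le> k" for m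
    using that member_le_sum[of m "{..k}" "\<lambda>m. \<bar>C m\<bar>"] by (intro decays_mono[OF C]) auto
  then show ?thesis by (intro exI[of _ "\<Sum>m\<le>k. \<bar>C m\<bar>"]) (auto intro: sum_nonneg)
qed

text \<open>Needed because the bulk fields carry a multiple of the derivative of the profile of the
  front.\<close>

lemma admissible_shift:
  assumes "admissible \<psi>"
  shows "admissible (\<lambda>m z. a * \<psi> (Suc m) z)"
  unfolding admissible_def derivative_chain_def
proof (intro conjI allI)
  show "((\<lambda>z. a * \<psi> (Suc m) z) has_field_derivative a * \<psi> (Suc (Suc m)) z) (at z)" for m z
    using assms by (intro DERIV_cmult) (simp add: admissible_def derivative_chain_def)
  show "\<exists>C. decays (\<lambda>z. a * \<psi> (Suc m) z) Y C" for m Y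
  proof -
    obtain C where C: "decays (\<psi> (Suc m)) Y C" using assms unfolding admissible_def by metis
    have "decays (\<lambda>z. a * \<psi> (Suc m) z) Y (norm a * C)"
      unfolding decays_def
    proof (intro allI impI)
      fix z assume "- Y \<le> Im z"
      then have "norm (\<psi> (Suc m) z) \<le> C * exp (- Im z) / (1 + norm z)" using C by (simp add: decays_def)
      from mult_left_mono[OF this norm_ge_zero[of a]]
      show "norm (a * \<psi> (Suc m) z) \<le> norm a * C * exp (- Im z) / (1 + norm z)"
        by (simp add: norm_mult mult.assoc)
    qed
    then show ?thesis ..
  qed
qed

text \<open>The successive derivatives of \<open>A * packet (n * z)\<close>, a superposition of the
  frequencies in [n, 2n]; the powers of \<open>n\<close> come from the chain rule.\<close>

definition wave :: "real \<Rightarrow> nat \<Rightarrow> nat \<Rightarrow> complex \<Rightarrow> complex" where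
  "wave A n m z = of_real (A * real n ^ m) * (deriv ^^ m) packet (of_nat n * z)"

text \<open>Explicit in \<open>n\<close>: for \<open>Y = 0\<close>, the initial time, the constant
  grows only polynomially, and the exponential in \<open>n\<close> enters through
  \<open>Y\<close>.\<close>

lemma wave_decays:
  assumes n: "1 \<le> n" and Y: "0 \<le> Y"
  shows "decays (wave A n m) Y (\<bar>A\<bar> * real n ^ m * (8 * exp 2 * fact m) * exp (2 * real n * Y))"
  unfolding decays_def
proof (intro allI impI)
  fix z assume z: "- Y \<le> Im z"
  let ?n = "real n" and ?y = "Im z"
  have n1: "1 \<le> ?n" using n by simp
  \<comment> \<open>As \<open>n\<close> is at least 1 and \<open>Im z + Y\<close> is nonnegative,
    these products show that both exponents \<open>- n * Im z\<close> and
    \<open>- 2 * n * Im z\<close> are at most \<open>2 * n * Y - Im z\<close>.\<close>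
  have "0 \<le> (?n - 1) * (?y + Y)" using n1 z by (intro mult_nonneg_nonneg) auto
  then have "0 \<le> ?n * ?y - ?y + ?n * Y - Y" by (simp add: algebra_simps)
  moreover have "0 \<le> ?n * (?y + Y)" using n1 z by (intro mult_nonneg_nonneg) auto
  then have "0 \<le> ?n * ?y + ?n * Y" by (simp add: algebra_simps)
  moreover have "0 \<le> ?n * Y" using Y by simp
  ultimately have "- (?n * ?y) \<le> 2 * (?n * Y) - ?y" "- 2 * (?n * ?y) \<le> 2 * (?n * Y) - ?y"
    using Y by linarith+
  then have "exp (- (?n * ?y)) \<le> exp (2 * (?n * Y) - ?y)" "exp (- 2 * (?n * ?y)) \<le> exp (2 * (?n * Y) - ?y)"
    unfolding exp_le_cancel_iff .
  then have e: "exp (- (?n * ?y)) + exp (- 2 * (?n * ?y)) \<le> 2 * (exp (2 * ?n * Y) * exp (- ?y))"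
    by (simp add: exp_add[symmetric] mult.assoc del: exp_le_cancel_iff)
  have nz: "1 + norm z \<le> 1 + ?n * norm z" using n1 by (simp add: mult_right_mono[of 1 ?n "norm z", simplified])
  have "norm ((deriv ^^ m) packet (of_nat n * z))
      \<le> 4 * exp 2 * fact m * (exp (- (?n * ?y)) + exp (- 2 * (?n * ?y))) / (1 + ?n * norm z)"
    using packet_deriv_norm[of m "of_nat n * z"] by (simp add: norm_mult mult.assoc)
  also have "\<dots> \<le> 4 * exp 2 * fact m * (2 * (exp (2 * ?n * Y) * exp (- ?y))) / (1 + norm z)"
    using e nz by (intro frac_le mult_left_mono) (auto simp: add_pos_nonneg intro!: mult_nonneg_nonneg)
  finally have "norm ((deriv ^^ m) packet (of_nat n * z))
      \<le> 4 * exp 2 * fact m * (2 * (exp (2 * ?n * Y) * exp (- ?y))) / (1 + norm z)" .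
  from mult_left_mono[OF this, of "\<bar>A\<bar> * ?n ^ m"]
  show "norm (wave A n m z) \<le> \<bar>A\<bar> * ?n ^ m * (8 * exp 2 * fact m) * exp (2 * ?n * Y) * exp (- ?y) / (1 + norm z)"
    by (simp add: wave_def norm_mult norm_power abs_mult power_abs mult.assoc)
qed

lemma wave_admissible:
  assumes n: "1 \<le> n"
  shows "admissible (wave A n)"
  unfolding admissible_def derivative_chain_def
proof (intro conjI allI)
  fix m z
  have "(deriv ^^ m) packet holomorphic_on UNIV"
    by (rule holomorphic_higher_deriv[OF packet_holomorphic open_UNIV])
  then have "((deriv ^^ m) packet has_field_derivative (deriv ^^ Suc m) packet (of_nat n * z)) (at (of_nat n * z))"
    by (simp add: holomorphic_derivI[OF _ open_UNIV])
  then have "((\<lambda>z. (deriv ^^ m) packet (of_nat n * z)) has_field_derivative (deriv ^^ Suc m) packet (of_nat n * z) * of_nat n) (at z)"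
    by (rule DERIV_chain2) (auto intro!: derivative_eq_intros)
  from DERIV_cmult[OF this, of "of_real (A * real n ^ m)"]
  show "(wave A n m has_field_derivative wave A n (Suc m) z) (at z)"
    by (simp add: wave_def[abs_def] ac_simps)
next
  fix m Y
  \<comment> \<open>Passing to the absolute value enlarges the region of decay, so negative
    \<open>Y\<close> is covered too.\<close>
  have "decays (wave A n m) \<bar>Y\<bar> (\<bar>A\<bar> * real n ^ m * (8 * exp 2 * fact m) * exp (2 * real n * \<bar>Y\<bar>))"
    using n by (rule wave_decays) simp
  then show "\<exists>C. decays (wave A n m) Y C"
    unfolding decays_def by (smt (verit))
qed

section \<open>Waves on a domain\<close>

lemma chain_vector_derivative:
  assumes "derivative_chain \<psi>"
  shows "((\<lambda>r. \<psi> m (z - \<i> * of_real (lam * r))) has_vector_derivative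
    - \<i> * of_real lam * \<psi> (Suc m) (z - \<i> * of_real (lam * r))) (at r within S)"
proof -
  have "bounded_linear (\<lambda>r. - \<i> * of_real lam * of_real r)"
    by (intro bounded_linear_const_mult bounded_linear_of_real)
  from has_derivative_profile[OF assms bounded_linear_ident this, of 1 m z r]
  have "((\<lambda>r. \<psi> m (z - \<i> * of_real (lam * r))) has_vector_derivative
    - \<i> * of_real lam * \<psi> (Suc m) (z - \<i> * of_real (lam * r))) (at r)"
    by (simp add: has_vector_derivative_def scaleR_conv_of_real ac_simps)
  then show ?thesis by (rule has_vector_derivative_at_within)
qed

text \<open>Common frame for the front on the line and the fields on a half-plane: \<open>L\<close>
  is the phase at time 0, and \<open>g\<close> is an integrable majorant of the squared decay
  envelope.\<close>

locale wave_domain =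
  fixes U :: "'a::euclidean_space set" and L :: "'a \<Rightarrow> complex" and g :: "'a \<Rightarrow> real"
  assumes open_U: "open U" and L: "bounded_linear L" and g: "set_integrable lebesgue U g"
    and Im_L: "x \<in> U \<Longrightarrow> 0 \<le> Im (L x)"
    and weight: "x \<in> U \<Longrightarrow> (exp (- Im (L x)) / (1 + \<bar>Re (L x)\<bar>))\<^sup>2 \<le> g x"
begin

text \<open>Shifting down by \<open>s\<close> multiplies the exponential by at most
  \<open>exp Y\<close>, while the real part of the phase is unchanged and still bounds the modulus
  from below.\<close>

lemma decays_pointwise:
  assumes F: "decays F Y C" and C: "0 \<le> C" and s: "0 \<le> s" "s \<le> Y" and x: "x \<in> U"
  shows "norm (F (L x - \<i> * of_real s)) \<le> C * exp Y * (exp (- Im (L x)) / (1 + \<bar>Re (L x)\<bar>))"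
proof -
  define z where "z = L x - \<i> * of_real s"
  have z: "Im z = Im (L x) - s" "Re z = Re (L x)" by (simp_all add: z_def)
  have "- Y \<le> Im z" using Im_L[OF x] s by (simp add: z)
  then have "norm (F z) \<le> C * exp (- Im z) / (1 + norm z)"
    using F by (simp add: decays_def)
  also have "\<dots> \<le> C * (exp Y * exp (- Im (L x))) / (1 + \<bar>Re (L x)\<bar>)"
    using C s abs_Re_le_cmod[of z] z(2)
    by (intro frac_le mult_left_mono) (auto simp: z(1) exp_add[symmetric])
  finally show ?thesis by (simp add: z_def)
qed

lemma square_le_weight:
  assumes "r \<le> B * (exp (- Im (L x)) / (1 + \<bar>Re (L x)\<bar>))" and "0 \<le> r" and x: "x \<in> U"
  shows "r\<^sup>2 \<le> B\<^sup>2 * g x"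
proof -
  have "r\<^sup>2 \<le> (B * (exp (- Im (L x)) / (1 + \<bar>Re (L x)\<bar>)))\<^sup>2"
    using assms(1,2) by (rule power_mono)
  also have "\<dots> \<le> B\<^sup>2 * g x"
    unfolding power_mult_distrib by (intro mult_left_mono weight x) simp
  finally show ?thesis .
qed

lemma wave_sobolev:
  fixes R :: "complex \<Rightarrow> 'b::euclidean_space"
  assumes "derivative_chain \<psi>" and R: "bounded_linear R"
    and C: "0 \<le> C" "\<And>m. m \<le> k \<Longrightarrow> decays (\<psi> m) Y C" and s: "0 \<le> s" "s \<le> Y"
    and u: "\<And>x. x \<in> U \<Longrightarrow> u x = R (\<psi> 0 (L x - \<i> * of_real s))"
  shows "u \<in> sobolev U k" and "0 \<le> sobolev_norm U k u"
    and "sobolev_norm U k u \<le> C * exp Y * profile_const U k R L g"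
    and "sqrt (LINT x:U|lebesgue. (norm (u x))\<^sup>2) \<le> sobolev_norm U k u"
proof -
  have u': "u x = R (\<psi> 0 (L x + - (\<i> * of_real s)))" if "x \<in> U" for x
    using u[OF that] by simp
  have bound: "(norm (\<psi> m (L x + - (\<i> * of_real s))))\<^sup>2 \<le> (C * exp Y)\<^sup>2 * g x" if "m \<le> k" "x \<in> U" for m x
    using decays_pointwise[OF C(2)[OF that(1)] C(1) s that(2)] that(2) by (intro square_le_weight) auto
  note * = profile_sobolev[OF assms(1) R L open_U u' g _ bound, of k]
  show "u \<in> sobolev U k" "0 \<le> sobolev_norm U k u"
    "sobolev_norm U k u \<le> C * exp Y * profile_const U k R L g"
    "sqrt (LINT x:U|lebesgue. (norm (u x))\<^sup>2) \<le> sobolev_norm U k u"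
    using C(1) by (auto intro!: *)
qed

text \<open>The difference of two time slices is again a profile, with chain \<eta>. The mean value
  inequality in the shift makes it Lipschitz at the price of one more derivative, hence
  \<open>Suc k\<close>.\<close>

lemma wave_sobolev_diff:
  fixes R :: "complex \<Rightarrow> 'b::euclidean_space"
  assumes chain: "derivative_chain \<psi>" and R: "bounded_linear R"
    and C: "0 \<le> C" "\<And>m. m \<le> Suc k \<Longrightarrow> decays (\<psi> m) Y C"
    and s: "0 \<le> s" "s \<le> Y" and s': "0 \<le> s'" "s' \<le> Y"
    and u: "\<And>x. x \<in> U \<Longrightarrow> u x = R (\<psi> 0 (L x - \<i> * of_real s)) - R (\<psi> 0 (L x - \<i> * of_real s'))"
  shows "sobolev_norm U k u \<le> \<bar>s - s'\<bar> * C * exp Y * profile_const U k R L g"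
    and "0 \<le> sobolev_norm U k u"
proof -
  define \<eta> where "\<eta> = (\<lambda>m z. \<psi> m (z - \<i> * of_real s) - \<psi> m (z - \<i> * of_real s'))"
  have deriv: "(\<psi> m has_field_derivative \<psi> (Suc m) z) (at z)" for m z
    using chain by (simp add: derivative_chain_def)
  have \<eta>: "derivative_chain \<eta>"
    unfolding derivative_chain_def \<eta>_def
    by (auto intro!: derivative_eq_intros DERIV_chain2[OF deriv])
  have "norm (\<eta> m (L x)) \<le> (\<bar>s - s'\<bar> * C * exp Y) * (exp (- Im (L x)) / (1 + \<bar>Re (L x)\<bar>))"
    if m: "m \<le> k" and x: "x \<in> U" for m x
  proof -
    let ?w = "exp (- Im (L x)) / (1 + \<bar>Re (L x)\<bar>)"
    let ?F = "\<lambda>r::real. \<psi> m (L x - \<i> * of_real r)"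
    have "norm (?F s - ?F s') \<le> (C * exp Y * ?w) * norm (s - s')"
    proof (rule differentiable_bound[of "{0..Y}"])
      fix r assume r: "r \<in> {0..Y}"
      have "(?F has_vector_derivative - \<i> * \<psi> (Suc m) (L x - \<i> * of_real r)) (at r within {0..Y})"
        using chain_vector_derivative[OF chain, of m "L x" 1 r] by simp
      then show "(?F has_derivative (\<lambda>h. h *\<^sub>R (- \<i> * \<psi> (Suc m) (L x - \<i> * of_real r)))) (at r within {0..Y})"
        by (simp add: has_vector_derivative_def)
      have "norm (\<psi> (Suc m) (L x - \<i> * of_real r)) \<le> C * exp Y * ?w"
        using m r x C by (intro decays_pointwise) auto
      then show "onorm (\<lambda>h. h *\<^sub>R (- \<i> * \<psi> (Suc m) (L x - \<i> * of_real r))) \<le> C * exp Y * ?w"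
        by (intro onorm_le) (simp only: norm_scaleR norm_mult norm_minus_cancel norm_ii mult_1 real_norm_def
            mult.commute[of "C * exp Y * ?w"] mult_left_mono abs_ge_zero)
    qed (use s s' in auto)
    then show ?thesis by (simp add: \<eta>_def ac_simps)
  qed
  then have bound: "(norm (\<eta> m (L x + 0)))\<^sup>2 \<le> (\<bar>s - s'\<bar> * C * exp Y)\<^sup>2 * g x" if "m \<le> k" "x \<in> U" for m x
    using that by (intro square_le_weight) auto
  have u': "u x = R (\<eta> 0 (L x + 0))" if "x \<in> U" for x
    using u[OF that] bounded_linear.linear[OF R] by (simp add: \<eta>_def linear_diff)
  note * = profile_sobolev[OF \<eta> R L open_U u' g _ bound, of k]
  show "sobolev_norm U k u \<le> \<bar>s - s'\<bar> * C * exp Y * profile_const U k R L g"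
    and "0 \<le> sobolev_norm U k u"
    using C(1) by (auto intro!: *)
qed

lemma wave_curve:
  fixes R :: "complex \<Rightarrow> 'b::euclidean_space"
  assumes \<psi>: "admissible \<psi>" and R: "bounded_linear R" and lam: "0 \<le> lam" and t: "0 \<le> t"
    and u: "\<And>t x. 0 \<le> t \<Longrightarrow> x \<in> U \<Longrightarrow> u t x = R (\<psi> 0 (L x - \<i> * of_real (lam * t)))"
  shows "((\<lambda>\<tau>. sobolev_norm U k (\<lambda>x. u \<tau> x - u t x)) \<longlongrightarrow> 0) (at t within {0..})"
proof -
  \<comment> \<open>Covers the shifts of all times up to \<open>t + 1\<close>, a neighbourhood of
    \<open>t\<close> in the half-line.\<close>
  define Y where "Y = lam * (t + 1)"
  obtain C where C: "0 \<le> C" "\<And>m. m \<le> Suc k \<Longrightarrow> decays (\<psi> m) Y C"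
    using admissible_uniform[OF \<psi>, of "Suc k" Y] by blast
  have chain: "derivative_chain \<psi>" using \<psi> by (simp add: admissible_def)
  let ?K = "C * exp Y * profile_const U k R L g"
  have ev: "\<forall>\<^sub>F \<tau> in at t within {0..}. 0 \<le> \<tau> \<and> \<tau> \<le> t + 1"
    unfolding eventually_at by (intro exI[of _ 1]) (auto simp: dist_real_def)
  have b: "norm (sobolev_norm U k (\<lambda>x. u \<tau> x - u t x)) \<le> \<bar>lam * \<tau> - lam * t\<bar> * ?K"
    if "0 \<le> \<tau> \<and> \<tau> \<le> t + 1" for \<tau>
  proof -
    have "0 \<le> lam * \<tau>" "lam * \<tau> \<le> Y" "0 \<le> lam * t" "lam * t \<le> Y"
      using that lam t by (auto simp: Y_def mult_left_mono)
    note * = wave_sobolev_diff[where k=k and u="\<lambda>x. u \<tau> x - u t x", OF chain R C this]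
    have "u \<tau> x - u t x = R (\<psi> 0 (L x - \<i> * of_real (lam * \<tau>))) - R (\<psi> 0 (L x - \<i> * of_real (lam * t)))"
      if "x \<in> U" for x using u that t \<open>0 \<le> \<tau> \<and> \<tau> \<le> t + 1\<close> by simp
    from *[OF _ this] show ?thesis by (simp add: mult.assoc)
  qed
  have "((\<lambda>\<tau>. \<bar>lam * \<tau> - lam * t\<bar> * ?K) \<longlongrightarrow> \<bar>lam * t - lam * t\<bar> * ?K) (at t within {0..})"
    by (intro tendsto_intros)
  then have "((\<lambda>\<tau>. \<bar>lam * \<tau> - lam * t\<bar> * ?K) \<longlongrightarrow> 0) (at t within {0..})" by simp
  then show ?thesis
    by (rule Lim_null_comparison[rotated]) (rule eventually_mono[OF ev b])
qed

end

section \<open>Time and space derivatives of waves\<close>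

lemma dt_profile:
  assumes \<psi>: "derivative_chain \<psi>" and R: "bounded_linear R" and t: "0 \<le> t"
    and u: "\<And>\<tau>. 0 \<le> \<tau> \<Longrightarrow> u \<tau> x = R (\<psi> 0 (z - \<i> * of_real (lam * \<tau>)))"
  shows "(\<lambda>\<tau>. u \<tau> x) differentiable (at t within {0..})"
    and "dt u t x = R (- \<i> * of_real lam * \<psi> 1 (z - \<i> * of_real (lam * t)))"
proof -
  have "((\<lambda>\<tau>::real. \<psi> 0 (z - \<i> * of_real (lam * \<tau>))) has_vector_derivative
      - \<i> * of_real lam * \<psi> 1 (z - \<i> * of_real (lam * t))) (at t within {0..})"
    using chain_vector_derivative[OF \<psi>, of 0] by simp
  from bounded_linear.has_vector_derivative[OF R this]
  have "((\<lambda>\<tau>. u \<tau> x) has_vector_derivative R (- \<i> * of_real lam * \<psi> 1 (z - \<i> * of_real (lam * t)))) (at t within {0..})"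
    by (rule has_vector_derivative_transform[rotated 2]) (use t u in auto)
  \<comment> \<open>Right neighbourhoods lie in the half-line, so the one-sided derivative is unique
    also at \<open>t = 0\<close>.\<close>
  moreover have "at_right t \<le> at t within {0..}"
    using t by (intro at_le) auto
  then have "at t within {0..} \<noteq> bot"
    using trivial_limit_at_right_real[of t] by (auto simp: bot_unique)
  ultimately show "dt u t x = R (- \<i> * of_real lam * \<psi> 1 (z - \<i> * of_real (lam * t)))"
    and "(\<lambda>\<tau>. u \<tau> x) differentiable (at t within {0..})"
    by (auto simp: dt_def vector_derivative_within has_vector_derivative_def differentiable_def)
qed

lemma pd_profile:
  fixes L :: "'a::euclidean_space \<Rightarrow> complex"
  assumes \<psi>: "derivative_chain \<psi>" and R: "bounded_linear R" and L: "bounded_linear L"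
    and U: "open U" "x \<in> U" and u: "\<And>y. y \<in> U \<Longrightarrow> u y = R (\<psi> 0 (L y - z0))"
  shows "u differentiable (at x)" and "pd b u x = R (L b * \<psi> 1 (L x - z0))"
proof -
  have "((\<lambda>x. R (1 * \<psi> 0 (L x + - z0))) has_derivative (\<lambda>h. R (1 * (L h * \<psi> (Suc 0) (L x + - z0))))) (at x)"
    by (rule has_derivative_profile[OF \<psi> R L])
  then have "(u has_derivative (\<lambda>h. R (L h * \<psi> 1 (L x - z0)))) (at x)"
    using has_derivative_transform_within_open[OF _ U] by (fastforce simp: u)
  then show "u differentiable (at x)" and "pd b u x = R (L b * \<psi> 1 (L x - z0))"
    by (auto simp: differentiable_def intro: pd_eqI)
qed

lemma continuous_profile:
  fixes L :: "'a::euclidean_space \<Rightarrow> complex"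
  assumes \<psi>: "derivative_chain \<psi>" and R: "bounded_linear R" and L: "bounded_linear L"
  shows "continuous_on S (\<lambda>(t, x). R (a * \<psi> m (L x - \<i> * of_real (lam * t))))"
proof -
  have "continuous_on UNIV (\<psi> m)"
    using \<psi> by (auto simp: derivative_chain_def intro!: DERIV_continuous continuous_at_imp_continuous_on)
  moreover have "continuous_on S (\<lambda>p::real \<times> 'a. L (snd p) - \<i> * of_real (lam * fst p))"
    by (intro continuous_intros bounded_linear.continuous_on[OF L])
  ultimately have "continuous_on S (\<lambda>p. \<psi> m (L (snd p) - \<i> * of_real (lam * fst p)))"
    by (rule continuous_on_compose2) auto
  then show ?thesis
    unfolding case_prod_beta by (intro bounded_linear.continuous_on[OF R] continuous_on_mult_left)
qed

lemma C1_on_profile: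
  fixes L :: "'a::euclidean_space \<Rightarrow> complex" and R :: "complex \<Rightarrow> 'b::euclidean_space"
  assumes \<psi>: "derivative_chain \<psi>" and R: "bounded_linear R" and L: "bounded_linear L" and U: "open U"
    and u: "\<And>t x. 0 \<le> t \<Longrightarrow> x \<in> U \<Longrightarrow> u t x = R (\<psi> 0 (L x - \<i> * of_real (lam * t)))"
  shows "C1_on U u"
  unfolding C1_on_def
proof (intro conjI allI impI ballI)
  show "(\<lambda>\<tau>. u \<tau> x) differentiable (at t within {0..})" if "0 \<le> t" "x \<in> U" for t x
    by (rule dt_profile[OF \<psi> R that(1)]) (use u that in auto)
  show "u t differentiable (at x)" if "0 \<le> t" "x \<in> U" for t x
    by (rule pd_profile[OF \<psi> R L U that(2)]) (use u that in auto)
  have dt: "dt u t x = R (- \<i> * of_real lam * \<psi> 1 (L x - \<i> * of_real (lam * t)))" if "0 \<le> t" "x \<in> U" for t x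
    by (rule dt_profile[OF \<psi> R that(1)]) (use u that in auto)
  have pd: "pd b (u t) x = R (L b * \<psi> 1 (L x - \<i> * of_real (lam * t)))" if "0 \<le> t" "x \<in> U" for t x b
    by (rule pd_profile[OF \<psi> R L U that(2)]) (use u that in auto)
  show "continuous_on ({0..} \<times> U) (\<lambda>(t, x). dt u t x)"
    by (rule continuous_on_eq[OF continuous_profile[OF \<psi> R L, of _ "- \<i> * of_real lam" 1 lam]])
       (auto simp: dt)
  show "continuous_on ({0..} \<times> U) (\<lambda>(t, x). pd b (u t) x)" for b
    by (rule continuous_on_eq[OF continuous_profile[OF \<psi> R L, of _ "L b" 1 lam]])
       (auto simp: pd)
qed

lemma continuous_curve_piecewiseI:
  assumes "\<And>s t. 0 \<le> t \<Longrightarrow> u t \<in> sobolev (halfplane s) k"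
    and "\<And>s t. 0 \<le> t \<Longrightarrow> ((\<lambda>\<tau>. sobolev_norm (halfplane s) k (\<lambda>x. u \<tau> x - u t x)) \<longlongrightarrow> 0) (at t within {0..})"
  shows "continuous_curve (piecewise_sobolev k) (piecewise_sobolev_norm k) u"
  unfolding continuous_curve_def piecewise_sobolev_def piecewise_sobolev_norm_def
proof (intro allI impI conjI)
  fix t :: real assume t: "0 \<le> t"
  show "u t \<in> sobolev (halfplane Plus) k \<inter> sobolev (halfplane Minus) k"
    using assms(1)[OF t] by blast
  have "((\<lambda>\<tau>. sqrt ((sobolev_norm (halfplane Plus) k (\<lambda>x. u \<tau> x - u t x))\<^sup>2 +
      (sobolev_norm (halfplane Minus) k (\<lambda>x. u \<tau> x - u t x))\<^sup>2)) \<longlongrightarrow> sqrt (0\<^sup>2 + 0\<^sup>2)) (at t within {0..})"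
    by (intro tendsto_intros assms(2) t)
  then show "((\<lambda>\<tau>. sqrt ((sobolev_norm (halfplane Plus) k (\<lambda>x. u \<tau> x - u t x))\<^sup>2 +
      (sobolev_norm (halfplane Minus) k (\<lambda>x. u \<tau> x - u t x))\<^sup>2)) \<longlongrightarrow> 0) (at t within {0..})"
    by simp
qed

section \<open>The line and the half-planes as wave domains, and traces on the interface\<close>

lemma wave_domain_real: "wave_domain UNIV of_real (\<lambda>x::real. inverse (1 + x\<^sup>2))"
proof (rule wave_domain.intro)
  show "bounded_linear (of_real :: real \<Rightarrow> complex)" by (rule bounded_linear_of_real)
  show "set_integrable lebesgue UNIV (\<lambda>x::real. inverse (1 + x\<^sup>2))"
    using integrable_lebesgue_weight1 by (simp add: set_integrable_def)
  fix x :: real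
  have "1 + x\<^sup>2 \<le> (1 + \<bar>x\<bar>)\<^sup>2" by (simp add: power2_eq_square algebra_simps)
  then show "(exp (- Im (of_real x)) / (1 + \<bar>Re (of_real x)\<bar>))\<^sup>2 \<le> inverse (1 + x\<^sup>2)"
    by (simp add: power_divide inverse_eq_divide frac_le add_pos_nonneg)
qed auto

text \<open>Chosen so that \<open>exp (\<i> * phase \<nu> x)\<close> oscillates in the first
  variable and has modulus \<open>exp (- Re \<nu> * snd x)\<close>.\<close>

definition phase :: "complex \<Rightarrow> real \<times> real \<Rightarrow> complex" where
  "phase \<nu> x = of_real (fst x) + \<i> * \<nu> * of_real (snd x)"

lemma Re_phase: "Re (phase \<nu> x) = fst x - Im \<nu> * snd x"
  and Im_phase: "Im (phase \<nu> x) = Re \<nu> * snd x"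
  by (simp_all add: phase_def)

lemma bounded_linear_phase: "bounded_linear (phase \<nu>)"
  unfolding phase_def
  by (intro bounded_linear_add bounded_linear_const_mult bounded_linear_compose[OF bounded_linear_of_real]
      bounded_linear_fst bounded_linear_snd)

lemma open_halfplane: "open (halfplane s)"
  by (cases s) (auto intro!: open_Collect_less continuous_intros)

definition plane_weight :: "real \<Rightarrow> real \<times> real \<Rightarrow> real" where
  "plane_weight r x = 16 / r ^ 4 * (inverse (1 + (fst x)\<^sup>2) * inverse (1 + (snd x)\<^sup>2))"

text \<open>The real part of the phase controls \<open>fst x\<close> only up to
  \<open>\<bar>snd x\<bar>\<close>. The exponential decay in \<open>snd x\<close> pays for this and
  for decay in \<open>snd x\<close> itself: two factors \<open>1 + y\<close> in all, each costing
  \<open>2 / r\<close>. Squaring the product yields \<open>16 / r ^ 4\<close>.\<close>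

lemma wave_domain_halfplane:
  assumes \<nu>: "norm \<nu> = 1" and r: "r = \<bar>Re \<nu>\<bar>" "0 < r"
    and sgn: "\<And>x. x \<in> halfplane s \<Longrightarrow> 0 \<le> Re \<nu> * snd x"
  shows "wave_domain (halfplane s) (phase \<nu>) (plane_weight r)"
  unfolding plane_weight_def
proof (rule wave_domain.intro)
  show "open (halfplane s)" by (rule open_halfplane)
  show "bounded_linear (phase \<nu>)" by (rule bounded_linear_phase)
  have "integrable lebesgue (\<lambda>x. 16 / r ^ 4 * (inverse (1 + (fst x)\<^sup>2) * inverse (1 + (snd x)\<^sup>2)))"
    using integrable_lebesgue_weight2 by (rule integrable_mult_right)
  then have "set_integrable lebesgue UNIV (\<lambda>x. 16 / r ^ 4 * (inverse (1 + (fst x)\<^sup>2) * inverse (1 + (snd x)\<^sup>2)))"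
    by (simp add: set_integrable_def)
  then show "set_integrable lebesgue (halfplane s) (\<lambda>x. 16 / r ^ 4 * (inverse (1 + (fst x)\<^sup>2) * inverse (1 + (snd x)\<^sup>2)))"
    by (rule set_integrable_subset) (simp_all add: open_halfplane)
  fix x assume x: "x \<in> halfplane s"
  show "0 \<le> Im (phase \<nu> x)" using sgn[OF x] by (simp add: Im_phase)
  have r1: "r \<le> 1" using abs_Re_le_cmod[of \<nu>] \<nu> r by simp
  define y where "y = \<bar>snd x\<bar>"
  have y: "0 \<le> y" by (simp add: y_def)
  define a where "a = 1 + \<bar>Re (phase \<nu> x)\<bar>"
  have Im: "Im (phase \<nu> x) = r * y"
    using sgn[OF x] r by (simp add: Im_phase y_def abs_mult[symmetric])
  have "\<bar>Im \<nu> * snd x\<bar> \<le> 1 * y"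
    unfolding abs_mult y_def using abs_Im_le_cmod[of \<nu>] \<nu> by (intro mult_right_mono) auto
  then have "\<bar>fst x\<bar> \<le> \<bar>Re (phase \<nu> x)\<bar> + y"
    by (simp add: Re_phase)
  also have "1 + (\<bar>Re (phase \<nu> x)\<bar> + y) \<le> a * (1 + y)"
    using y by (simp add: a_def algebra_simps)
  finally have xa: "1 + \<bar>fst x\<bar> \<le> a * (1 + y)" by simp
  \<comment> \<open>Half the decay rate is spent on each factor \<open>1 + y\<close>; the inequality
    uses that \<open>r\<close> is at most 1.\<close>
  have "1 + y \<le> 2 / r * (1 + r * y / 2)"
    using r r1 y by (simp add: field_simps)
  also have "\<dots> \<le> 2 / r * exp (r * y / 2)"
    using r by (intro mult_left_mono exp_ge_add_one_self) auto
  finally have "(1 + y)\<^sup>2 \<le> (2 / r * exp (r * y / 2))\<^sup>2"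
    using y by (intro power_mono) auto
  also have "\<dots> = 4 / r\<^sup>2 * exp (r * y)"
    by (simp add: power_mult_distrib power_divide exp_of_nat_mult[symmetric])
  finally have e: "exp (- (r * y)) * (1 + y)\<^sup>2 \<le> 4 / r\<^sup>2"
    by (simp add: exp_minus field_simps)
  have a0: "0 < a" by (simp add: a_def add_pos_nonneg)
  have "exp (- (r * y)) * ((1 + \<bar>fst x\<bar>) * (1 + y)) \<le> exp (- (r * y)) * (a * (1 + y) * (1 + y))"
    using xa y by (intro mult_left_mono mult_right_mono) auto
  also have "\<dots> = a * (exp (- (r * y)) * (1 + y)\<^sup>2)"
    by (simp add: power2_eq_square)
  also have "\<dots> \<le> a * (4 / r\<^sup>2)"
    using e a0 by (intro mult_left_mono) auto
  finally have "exp (- (r * y)) / a \<le> (4 / r\<^sup>2) / ((1 + \<bar>fst x\<bar>) * (1 + y))"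
  proof -
    assume *: "exp (- (r * y)) * ((1 + \<bar>fst x\<bar>) * (1 + y)) \<le> a * (4 / r\<^sup>2)"
    have "0 < (1 + \<bar>fst x\<bar>) * (1 + y)" using y by (intro mult_pos_pos) auto
    then have "exp (- (r * y)) \<le> a * (4 / r\<^sup>2) / ((1 + \<bar>fst x\<bar>) * (1 + y))"
      using * by (simp only: pos_le_divide_eq)
    then show ?thesis
      unfolding pos_divide_le_eq[OF a0] by (simp only: mult.commute[of _ a] times_divide_eq_right)
  qed
  then have "(exp (- (r * y)) / a)\<^sup>2 \<le> ((4 / r\<^sup>2) / ((1 + \<bar>fst x\<bar>) * (1 + y)))\<^sup>2"
    using a0 by (intro power_mono) auto
  also have "\<dots> = 16 / r ^ 4 / ((1 + \<bar>fst x\<bar>)\<^sup>2 * (1 + y)\<^sup>2)"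
    by (simp add: power_divide power_mult_distrib flip: power_mult)
  also have "\<dots> \<le> 16 / r ^ 4 / ((1 + (fst x)\<^sup>2) * (1 + (snd x)\<^sup>2))"
  proof (rule divide_left_mono)
    have "1 + (fst x)\<^sup>2 \<le> (1 + \<bar>fst x\<bar>)\<^sup>2" "1 + (snd x)\<^sup>2 \<le> (1 + y)\<^sup>2"
      by (simp_all add: y_def power2_eq_square algebra_simps)
    then show "(1 + (fst x)\<^sup>2) * (1 + (snd x)\<^sup>2) \<le> (1 + \<bar>fst x\<bar>)\<^sup>2 * (1 + y)\<^sup>2"
      by (rule mult_mono) simp_all
    have "0 < (1 + \<bar>fst x\<bar>) * (1 + y)" using y by (intro mult_pos_pos) auto
    then have "0 < ((1 + \<bar>fst x\<bar>) * (1 + y))\<^sup>2" by (rule zero_less_power)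
    moreover have "0 < (1 + (fst x)\<^sup>2) * (1 + (snd x)\<^sup>2)"
      by (intro mult_pos_pos add_pos_nonneg) auto
    ultimately show "0 < (1 + \<bar>fst x\<bar>)\<^sup>2 * (1 + y)\<^sup>2 * ((1 + (fst x)\<^sup>2) * (1 + (snd x)\<^sup>2))"
      unfolding power_mult_distrib by (rule mult_pos_pos)
  qed simp
  finally have final: "(exp (- (r * y)) / a)\<^sup>2 \<le> 16 / r ^ 4 / ((1 + (fst x)\<^sup>2) * (1 + (snd x)\<^sup>2))" .
  have "16 / r ^ 4 / ((1 + (fst x)\<^sup>2) * (1 + (snd x)\<^sup>2))
      = 16 / r ^ 4 * (inverse (1 + (fst x)\<^sup>2) * inverse (1 + (snd x)\<^sup>2))"
    by (simp add: divide_inverse)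
  with final show "(exp (- Im (phase \<nu> x)) / (1 + \<bar>Re (phase \<nu> x)\<bar>))\<^sup>2
      \<le> 16 / r ^ 4 * (inverse (1 + (fst x)\<^sup>2) * inverse (1 + (snd x)\<^sup>2))"
    by (simp add: Im a_def)
qed

lemma side_trace_eq:
  assumes u: "\<And>x. x \<in> halfplane s \<Longrightarrow> u x = F x" and F: "continuous_on UNIV F"
  shows "side_trace s u x1 = F (x1, 0)"
  unfolding side_trace_def
proof (rule tendsto_Lim)
  \<comment> \<open>The filter must be nontrivial for \<open>Lim\<close> to be determined by the
    limit.\<close>
  have "(x1, 0) islimpt halfplane s"
    unfolding islimpt_approachable
  proof (intro allI impI)
    fix e :: real assume "0 < e"
    then show "\<exists>x'\<in>halfplane s. x' \<noteq> (x1, 0) \<and> dist x' (x1, 0) < e"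
      by (cases s; intro bexI[of _ "(x1, if s = Plus then e / 2 else - e / 2)"]) (auto simp: dist_Pair_Pair)
  qed
  then show "at (x1, 0) within halfplane s \<noteq> bot" by (simp add: trivial_limit_within)
  have "(F \<longlongrightarrow> F (x1, 0)) (at (x1, 0) within halfplane s)"
    using F by (meson continuous_on_def iso_tuple_UNIV_I subset_UNIV tendsto_within_subset)
  then show "(u \<longlongrightarrow> F (x1, 0)) (at (x1, 0) within halfplane s)"
    by (rule Lim_transform_eventually) (auto simp: eventually_at_filter u)
qed

definition side_of :: "real \<times> real \<Rightarrow> side" where
  "side_of x = (if 0 < snd x then Plus else Minus)"

lemma side_of_halfplane: "x \<in> halfplane s \<Longrightarrow> side_of x = s"
  by (cases s) (auto simp: side_of_def)

lemma Re_complex_of_real_mult: "Re (of_real r * z) = r * Re z"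
  by simp

section \<open>The unstable normal mode\<close>

text \<open>The algebra of one growing mode. \<open>Re_nu\<close> is decay away from the interface,
  \<open>nu_jump\<close> is continuity of \<open>h\<close> across it, and \<open>dispersion\<close>
  is what remains on each side after \<open>v\<close> and \<open>G\<close> are eliminated.\<close>

locale unstable_mode =
  fixes c lam :: real and vd :: "side \<Rightarrow> real" and Gd :: "side \<Rightarrow> nat \<Rightarrow> real" and nu :: "side \<Rightarrow> complex"
  assumes lam: "0 < lam" and vd: "vd Plus = - vd Minus"
    and norm_nu: "norm (nu s) = 1" and Re_nu: "x \<in> halfplane s \<Longrightarrow> 0 < Re (nu s) * snd x"
    and nu_jump: "nu Plus - inverse (nu Plus) = nu Minus - inverse (nu Minus)"
    and dispersion: "of_real (c\<^sup>2) * ((nu s)\<^sup>2 - 1)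
      = (of_real lam + \<i> * of_real (vd s))\<^sup>2 + of_real ((Gd s 1)\<^sup>2 + (Gd s 2)\<^sup>2)"
begin

definition field :: "(side \<Rightarrow> complex \<Rightarrow> 'b) \<Rightarrow> (complex \<Rightarrow> complex) \<Rightarrow> real \<Rightarrow> real \<times> real \<Rightarrow> 'b" where
  "field R F t x = R (side_of x) (F (phase (nu (side_of x)) x - \<i> * of_real (lam * t)))"

definition front_of :: "(complex \<Rightarrow> complex) \<Rightarrow> front" where
  "front_of F t x1 = Re (F (of_real x1 - \<i> * of_real (lam * t)))"

definition bound_const :: "nat \<Rightarrow> (side \<Rightarrow> complex \<Rightarrow> 'b::euclidean_space) \<Rightarrow> real" where
  "bound_const k R = (\<Sum>s\<in>{Plus, Minus}. profile_const (halfplane s) k (R s) (phase (nu s)) (plane_weight \<bar>Re (nu s)\<bar>))"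

lemma nu_nonzero: "nu s \<noteq> 0"
  using norm_nu[of s] by auto

lemma Re_nu_nonzero: "Re (nu s) \<noteq> 0"
  using Re_nu[of "(0, if s = Plus then 1 else - 1)" s] by (cases s) auto

lemma domain: "wave_domain (halfplane s) (phase (nu s)) (plane_weight \<bar>Re (nu s)\<bar>)"
  using norm_nu Re_nu Re_nu_nonzero by (intro wave_domain_halfplane) (auto intro: less_imp_le)

lemma field_halfplane:
  "x \<in> halfplane s \<Longrightarrow> field R F t x = R s (F (phase (nu s) x - \<i> * of_real (lam * t)))"
  by (simp add: field_def side_of_halfplane)

lemma field_classical:
  fixes R :: "side \<Rightarrow> complex \<Rightarrow> 'b::euclidean_space"
  assumes \<psi>: "derivative_chain \<psi>" and R: "\<And>s. bounded_linear (R s)"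
  shows "classical_field (field R (\<psi> 0))"
  unfolding classical_field_def extends_continuously_def
proof (intro allI conjI)
  fix s
  show "C1_on (halfplane s) (field R (\<psi> 0))"
    by (rule C1_on_profile[OF \<psi> R bounded_linear_phase open_halfplane], rule field_halfplane)
  show "\<exists>w. continuous_on ({0..} \<times> closure (halfplane s)) w \<and>
      (\<forall>t\<ge>0. \<forall>x\<in>halfplane s. w (t, x) = field R (\<psi> 0) t x)"
    using continuous_profile[OF \<psi> R bounded_linear_phase, of "{0..} \<times> closure (halfplane s)" s 1 0 "nu s" lam]
    by (intro exI conjI) (auto simp: field_halfplane)
qed

lemma field_sobolev:
  fixes R :: "side \<Rightarrow> complex \<Rightarrow> 'b::euclidean_space"
  assumes \<psi>: "admissible \<psi>" and R: "\<And>s. bounded_linear (R s)" and t: "0 \<le> t"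
  shows "field R (\<psi> 0) t \<in> sobolev (halfplane s) k"
proof -
  obtain C where C: "0 \<le> C" "\<And>m. m \<le> k \<Longrightarrow> decays (\<psi> m) (lam * t) C"
    using admissible_uniform[OF \<psi>] by blast
  have "derivative_chain \<psi>" using \<psi> by (simp add: admissible_def)
  then show ?thesis
    by (rule wave_domain.wave_sobolev(1)[OF domain _ R C _ order_refl])
       (use lam t field_halfplane in auto)
qed

lemma field_curve:
  fixes R :: "side \<Rightarrow> complex \<Rightarrow> 'b::euclidean_space"
  assumes \<psi>: "admissible \<psi>" and R: "\<And>s. bounded_linear (R s)"
  shows "continuous_curve (piecewise_sobolev k) (piecewise_sobolev_norm k) (field R (\<psi> 0))"
proof (rule continuous_curve_piecewiseI)
  show "field R (\<psi> 0) t \<in> sobolev (halfplane s) k" if "0 \<le> t" for s t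
    using \<psi> R that by (rule field_sobolev)
  show "((\<lambda>\<tau>. sobolev_norm (halfplane s) k (\<lambda>x. field R (\<psi> 0) \<tau> x - field R (\<psi> 0) t x)) \<longlongrightarrow> 0)
      (at t within {0..})" if "0 \<le> t" for s t
    by (rule wave_domain.wave_curve[OF domain \<psi> R less_imp_le[OF lam] that], rule field_halfplane)
qed

lemma field_initial_norm:
  fixes R :: "side \<Rightarrow> complex \<Rightarrow> 'b::euclidean_space"
  assumes \<psi>: "derivative_chain \<psi>" and R: "\<And>s. bounded_linear (R s)"
    and C: "0 \<le> C" "\<And>m. m \<le> k \<Longrightarrow> decays (\<psi> m) 0 C"
  shows "piecewise_sobolev_norm k (field R (\<psi> 0) 0) \<le> C * bound_const k R"
proof -
  have eq: "field R (\<psi> 0) 0 x = R s (\<psi> 0 (phase (nu s) x - \<i> * of_real 0))" if "x \<in> halfplane s" for s x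
    using field_halfplane[OF that, of R "\<psi> 0" 0] by simp
  have *: "0 \<le> sobolev_norm (halfplane s) k (field R (\<psi> 0) 0)"
      "sobolev_norm (halfplane s) k (field R (\<psi> 0) 0) \<le> C * exp 0 * profile_const (halfplane s) k (R s) (phase (nu s)) (plane_weight \<bar>Re (nu s)\<bar>)" for s
    by (rule wave_domain.wave_sobolev(2,3)[OF domain \<psi> R C order_refl order_refl], assumption, erule eq)+
  have "piecewise_sobolev_norm k (field R (\<psi> 0) 0)
      \<le> \<bar>sobolev_norm (halfplane Plus) k (field R (\<psi> 0) 0)\<bar> + \<bar>sobolev_norm (halfplane Minus) k (field R (\<psi> 0) 0)\<bar>"
    unfolding piecewise_sobolev_norm_def by (rule sqrt_sum_squares_le_sum_abs)
  also have "\<dots> \<le> C * bound_const k R"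
    using *[of Plus] *[of Minus] by (simp add: bound_const_def distrib_left del: halfplane.simps)
  finally show ?thesis .
qed

lemma field_dt:
  assumes \<psi>: "derivative_chain \<psi>" and R: "\<And>s. bounded_linear (R s)" and t: "0 \<le> t" and x: "x \<in> halfplane s"
  shows "dt (field R (\<psi> 0)) t x = R s (- \<i> * of_real lam * \<psi> 1 (phase (nu s) x - \<i> * of_real (lam * t)))"
  by (rule dt_profile(2)[OF \<psi> R t]) (simp add: field_halfplane[OF x])

lemma field_pd:
  fixes R :: "side \<Rightarrow> complex \<Rightarrow> 'b::euclidean_space"
  assumes \<psi>: "derivative_chain \<psi>" and R: "\<And>s. bounded_linear (R s)" and x: "x \<in> halfplane s"
  shows "d1 (field R (\<psi> 0) t) x = R s (\<psi> 1 (phase (nu s) x - \<i> * of_real (lam * t)))"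
    and "d2 (field R (\<psi> 0) t) x = R s (\<i> * nu s * \<psi> 1 (phase (nu s) x - \<i> * of_real (lam * t)))"
proof -
  have "pd b (field R (\<psi> 0) t) x = R s (phase (nu s) b * \<psi> 1 (phase (nu s) x - \<i> * of_real (lam * t)))" for b
    by (rule pd_profile(2)[OF \<psi> R bounded_linear_phase open_halfplane x], rule field_halfplane)
  then show "d1 (field R (\<psi> 0) t) x = R s (\<psi> 1 (phase (nu s) x - \<i> * of_real (lam * t)))"
    and "d2 (field R (\<psi> 0) t) x = R s (\<i> * nu s * \<psi> 1 (phase (nu s) x - \<i> * of_real (lam * t)))"
    by (simp_all add: phase_def)
qed

lemma field_trace:
  fixes R :: "side \<Rightarrow> complex \<Rightarrow> 'b::euclidean_space"
  assumes \<psi>: "derivative_chain \<psi>" and R: "\<And>s. bounded_linear (R s)" and p: "continuous_on UNIV p"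
  shows "side_trace s (\<lambda>x. p (field R (\<psi> 0) t x)) x1 = p (R s (\<psi> 0 (of_real x1 - \<i> * of_real (lam * t))))"
proof -
  let ?F = "\<lambda>x. p (R s (\<psi> 0 (phase (nu s) x - \<i> * of_real (lam * t))))"
  have "continuous_on UNIV (\<psi> 0)"
    using \<psi> by (auto simp: derivative_chain_def intro!: DERIV_continuous continuous_at_imp_continuous_on)
  moreover have "continuous_on UNIV (\<lambda>x. phase (nu s) x - \<i> * of_real (lam * t))"
    by (intro continuous_on_diff continuous_on_const bounded_linear.continuous_on[OF bounded_linear_phase] continuous_on_id)
  ultimately have "continuous_on UNIV (\<lambda>x. \<psi> 0 (phase (nu s) x - \<i> * of_real (lam * t)))"
    by (rule continuous_on_compose2) auto
  then have "continuous_on UNIV (\<lambda>x. R s (\<psi> 0 (phase (nu s) x - \<i> * of_real (lam * t))))"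
    by (rule bounded_linear.continuous_on[OF R])
  then have "continuous_on UNIV ?F"
    by (rule continuous_on_compose2[OF p]) auto
  then have "side_trace s (\<lambda>x. p (field R (\<psi> 0) t x)) x1 = ?F (x1, 0)"
    by (rule side_trace_eq[rotated]) (simp add: field_halfplane)
  then show ?thesis by (simp add: phase_def)
qed

text \<open>Along a wave, \<open>\<partial>\<^sub>t + v \<partial>\<^sub>1\<close>, \<open>\<partial>\<^sub>1\<close>, \<open>\<partial>\<^sub>2\<close> act on the profile as \<open>- \<i> sigma\<close>, \<open>1\<close>, \<open>\<i> nu\<close> times its derivative.
  The amplitudes below solve the resulting linear system, normalized so that the front has amplitude one
  and all fields share the profile \<open>- \<i> \<Phi>'\<close> when the front has the profile \<open>\<Phi>\<close>.\<close>

definition sigma :: "side \<Rightarrow> complex" where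
  "sigma s = of_real lam + \<i> * of_real (vd s)"

definition amp_h :: "side \<Rightarrow> complex \<Rightarrow> real" where
  "amp_h s z = Re ((nu s - inverse (nu s)) * z)"

definition amp_v :: "side \<Rightarrow> complex \<Rightarrow> real \<times> real" where
  "amp_v s z = (Re (- \<i> * sigma s * inverse (nu s) * z), Re (sigma s * z))"

definition amp_G :: "nat \<Rightarrow> side \<Rightarrow> complex \<Rightarrow> real \<times> real" where
  "amp_G j s z = (Re (of_real (Gd s j) * inverse (nu s) * z), Re (\<i> * of_real (Gd s j) * z))"

lemma bounded_linear_amp [simp]:
  "bounded_linear (amp_h s)" "bounded_linear (amp_v s)" "bounded_linear (amp_G j s)"
proof -
  have *: "bounded_linear (\<lambda>z. Re (a * z))" for a
    by (rule bounded_linear_compose[OF bounded_linear_Re bounded_linear_mult_right])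
  show "bounded_linear (amp_h s)" unfolding amp_h_def by (rule *)
  show "bounded_linear (amp_v s)" unfolding amp_v_def by (intro bounded_linear_Pair *)
  show "bounded_linear (amp_G j s)" unfolding amp_G_def by (intro bounded_linear_Pair *)
qed

section \<open>Balance laws for the amplitudes, and the modes as solutions\<close>

lemma minus_ii_sigma: "- \<i> * sigma s = of_real (vd s) - \<i> * of_real lam"
  by (simp add: sigma_def algebra_simps)

text \<open>The first two terms combine to transport of \<open>h\<close> with factor
  \<open>- \<i> * sigma s\<close>; the coefficients of \<open>nu s\<close> and of its inverse then
  cancel separately.\<close>

lemma mass_balance:
  "amp_h s (- \<i> * of_real lam * p) + vd s * amp_h s p + fst (amp_v s p) + snd (amp_v s (\<i> * nu s * p)) = 0"
proof -
  let ?n = "nu s" let ?i = "inverse (nu s)"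
  have "(?n - ?i) * (- \<i> * of_real lam) + of_real (vd s) * (?n - ?i) + - \<i> * sigma s * ?i + sigma s * (\<i> * ?n)
      = (?n - ?i) * (- \<i> * sigma s) + - \<i> * sigma s * ?i + sigma s * (\<i> * ?n)"
    unfolding minus_ii_sigma by (simp add: algebra_simps)
  also have "\<dots> = 0" by (simp add: algebra_simps)
  finally have "Re (((?n - ?i) * (- \<i> * of_real lam) + of_real (vd s) * (?n - ?i) + - \<i> * sigma s * ?i + sigma s * (\<i> * ?n)) * p) = 0"
    by simp
  moreover have "vd s * amp_h s p = Re (of_real (vd s) * ((?n - ?i) * p))"
    by (simp add: amp_h_def)
  ultimately show ?thesis
    by (simp only: amp_h_def amp_v_def fst_conv snd_conv plus_complex.sel(1)[symmetric] ring_distribs mult.assoc)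
qed

text \<open>Both components are the dispersion relation, the first divided by \<open>nu s\<close>
  and the second multiplied by \<i>.\<close>

lemma momentum_balance:
  "amp_v s (- \<i> * of_real lam * p) + vd s *\<^sub>R amp_v s p + c\<^sup>2 *\<^sub>R (amp_h s p, amp_h s (\<i> * nu s * p))
    = (\<Sum>j\<in>{1,2}. Gd s j *\<^sub>R amp_G j s p)"
proof -
  let ?n = "nu s" and ?i = "inverse (nu s)" and ?S = "sigma s"
  let ?c = "of_real (c\<^sup>2) :: complex" and ?G = "of_real ((Gd s 1)\<^sup>2 + (Gd s 2)\<^sup>2) :: complex"
  have ni: "?n * ?i = 1" using nu_nonzero by simp
  have disp: "?c * (?n * ?n - 1) = ?S * ?S + ?G"
    using dispersion by (simp add: sigma_def power2_eq_square)
  have 1: "- \<i> * ?S * ?i * (- \<i> * ?S) + ?c * (?n - ?i) = ?G * ?i"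
  proof -
    have "?c * (?n - ?i) = ?c * (?n * ?n - 1) * ?i"
      using ni by (simp add: algebra_simps)
    then show ?thesis unfolding disp by (simp add: algebra_simps)
  qed
  have 2: "?S * (- \<i> * ?S) + ?c * ((?n - ?i) * (\<i> * ?n)) = \<i> * ?G"
  proof -
    have "?c * ((?n - ?i) * (\<i> * ?n)) = \<i> * (?c * (?n * ?n - 1))"
      using ni by (simp add: algebra_simps)
    then show ?thesis unfolding disp by (simp add: algebra_simps)
  qed
  have lin: "Re (a * (- \<i> * of_real lam * p)) + vd s * Re (a * p) = Re (a * (- \<i> * ?S) * p)" for a
    unfolding minus_ii_sigma by (simp add: algebra_simps)
  have "Re ((- \<i> * ?S * ?i * (- \<i> * ?S) + ?c * (?n - ?i)) * p) = Re (?G * ?i * p)"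
    "Re ((?S * (- \<i> * ?S) + ?c * ((?n - ?i) * (\<i> * ?n))) * p) = Re (\<i> * ?G * p)"
    unfolding 1 2 by simp_all
  then have
    "Re (- \<i> * ?S * ?i * (- \<i> * ?S) * p) + c\<^sup>2 * Re ((?n - ?i) * p) = Re (?G * ?i * p)"
    "Re (?S * (- \<i> * ?S) * p) + c\<^sup>2 * Re ((?n - ?i) * (\<i> * ?n * p)) = Re (\<i> * ?G * p)"
    by (simp_all only: distrib_right plus_complex.sel mult.assoc Re_complex_of_real_mult)
  moreover have "Re (?G * ?i * p) = Gd s 1 * Re (of_real (Gd s 1) * ?i * p) + Gd s 2 * Re (of_real (Gd s 2) * ?i * p)"
    "Re (\<i> * ?G * p) = Gd s 1 * Re (\<i> * of_real (Gd s 1) * p) + Gd s 2 * Re (\<i> * of_real (Gd s 2) * p)"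
    by (simp_all add: power2_eq_square algebra_simps)
  ultimately show ?thesis
    unfolding lin[symmetric] by (simp add: amp_h_def amp_v_def amp_G_def del: times_complex.sel)
qed

text \<open>\<open>amp_G\<close> is built from \<open>amp_v\<close> by dividing by the transport
  factor \<open>- \<i> * sigma s\<close> and multiplying by \<open>Gd s j\<close>.\<close>

lemma stretching_balance:
  "amp_G j s (- \<i> * of_real lam * p) + vd s *\<^sub>R amp_G j s p = Gd s j *\<^sub>R amp_v s p"
proof -
  have lin: "Re (a * (- \<i> * of_real lam * p)) + vd s * Re (a * p) = Re (a * (- \<i> * sigma s) * p)" for a
    unfolding minus_ii_sigma by (simp add: algebra_simps)
  have *: "of_real (Gd s j) * inverse (nu s) * (- \<i> * sigma s) * p = of_real (Gd s j) * (- \<i> * sigma s * inverse (nu s) * p)"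
    "\<i> * of_real (Gd s j) * (- \<i> * sigma s) * p = of_real (Gd s j) * (sigma s * p)"
    by (simp_all add: algebra_simps)
  show ?thesis
    unfolding amp_G_def amp_v_def scaleR_Pair add_Pair real_scaleR_def lin * Re_complex_of_real_mult ..
qed

text \<open>The interior equations are the three balance laws. On the interface all phases reduce to
  \<open>x1\<close>, so the kinematic and boundary conditions become identities between amplitudes
  applied to the single number \<psi>'.\<close>

lemma mode_solution:
  assumes \<psi>: "admissible \<psi>"
  defines "\<Psi> \<equiv> \<lambda>m z. - \<i> * \<psi> (Suc m) z"
  shows "solution c vd Gd m (front_of (\<psi> 0)) (field amp_h (\<Psi> 0)) (field amp_v (\<Psi> 0))
    (\<lambda>j. field (amp_G j) (\<Psi> 0))"
proof -
  have \<Psi>: "admissible \<Psi>" unfolding \<Psi>_def using \<psi> by (rule admissible_shift)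
  have chain: "derivative_chain \<psi>" "derivative_chain \<Psi>" using \<psi> \<Psi> by (simp_all add: admissible_def)
  have front: "front_of (\<psi> 0) t x = Re (\<psi> 0 (of_real x - \<i> * of_real (lam * t)))" for t x
    by (simp add: front_of_def)
  have front_pd: "pd 1 (front_of (\<psi> 0) t) x = Re (\<psi> 1 (of_real x - \<i> * of_real (lam * t)))" for t x
    using pd_profile(2)[OF chain(1) bounded_linear_Re bounded_linear_of_real open_UNIV UNIV_I front] by simp
  have front_dt: "dt (front_of (\<psi> 0)) t x = Re (- \<i> * of_real lam * \<psi> 1 (of_real x - \<i> * of_real (lam * t)))"
    if "0 \<le> t" for t x
    by (rule dt_profile(2)[OF chain(1) bounded_linear_Re that], rule front)
  \<comment> \<open>Both sides share the profile on the interface, so equal amplitudes make the jump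
    of \<open>h\<close> vanish.\<close>
  have amp_h_jump: "amp_h Plus = amp_h Minus"
    by (simp only: amp_h_def[abs_def] nu_jump)
  have trace_v: "side_trace s (\<lambda>x. snd (field amp_v (\<Psi> 0) t x)) x1
      = Re (sigma s * (- \<i> * \<psi> 1 (of_real x1 - \<i> * of_real (lam * t))))" for s t x1
    by (subst field_trace[OF chain(2) bounded_linear_amp(2) continuous_on_snd[OF continuous_on_id]])
       (simp add: amp_v_def \<Psi>_def)
  have trace_h: "side_trace s (\<lambda>x. field amp_h (\<Psi> 0) t x) x1
      = amp_h s (\<Psi> 0 (of_real x1 - \<i> * of_real (lam * t)))" for s t x1
    by (rule field_trace[OF chain(2) bounded_linear_amp(1) continuous_on_id])
  have trace_G: "side_trace s (\<lambda>x. snd (field (amp_G j) (\<Psi> 0) t x)) x1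
      = Gd s j * Re (\<psi> 1 (of_real x1 - \<i> * of_real (lam * t)))" for s t x1 j
    by (subst field_trace[OF chain(2) bounded_linear_amp(3) continuous_on_snd[OF continuous_on_id]])
       (simp add: amp_G_def \<Psi>_def)
  have "C1_on UNIV (front_of (\<psi> 0))"
    by (rule C1_on_profile[OF chain(1) bounded_linear_Re bounded_linear_of_real open_UNIV front])
  moreover have "continuous_curve (sobolev UNIV m) (sobolev_norm UNIV m) (front_of (\<psi> 0))"
    unfolding continuous_curve_def
  proof (intro allI impI conjI)
    fix t :: real assume t: "0 \<le> t"
    obtain C where C: "0 \<le> C" "\<And>i. i \<le> m \<Longrightarrow> decays (\<psi> i) (lam * t) C"
      using admissible_uniform[OF \<psi>] by blast
    show "front_of (\<psi> 0) t \<in> sobolev UNIV m"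
      by (rule wave_domain.wave_sobolev(1)[OF wave_domain_real chain(1) bounded_linear_Re C _ order_refl front])
         (use lam t in auto)
    show "((\<lambda>\<tau>. sobolev_norm UNIV m (\<lambda>x. front_of (\<psi> 0) \<tau> x - front_of (\<psi> 0) t x)) \<longlongrightarrow> 0) (at t within {0..})"
      by (rule wave_domain.wave_curve[OF wave_domain_real \<psi> bounded_linear_Re less_imp_le[OF lam] t front])
  qed
  moreover have "system_L c vd Gd (front_of (\<psi> 0)) (field amp_h (\<Psi> 0)) (field amp_v (\<Psi> 0))
      (\<lambda>j. field (amp_G j) (\<Psi> 0))"
    unfolding system_L_def
  proof (intro allI impI conjI ballI)
    fix t :: real and s x assume t: "0 \<le> t" and x: "x \<in> halfplane s"
    note eqs = field_dt[OF chain(2) _ t x] field_pd[OF chain(2) _ x]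
    show "dt (field amp_h (\<Psi> 0)) t x + vd s * d1 (field amp_h (\<Psi> 0) t) x + divergence (field amp_v (\<Psi> 0) t) x = 0"
      unfolding divergence_def using mass_balance by (simp add: eqs add.assoc)
    show "dt (field amp_v (\<Psi> 0)) t x + vd s *\<^sub>R d1 (field amp_v (\<Psi> 0) t) x + c\<^sup>2 *\<^sub>R grad (field amp_h (\<Psi> 0) t) x
        = (\<Sum>j\<in>{1,2}. Gd s j *\<^sub>R d1 (field (amp_G j) (\<Psi> 0) t) x)"
      unfolding grad_def using momentum_balance by (simp add: eqs)
    show "dt (field (amp_G j) (\<Psi> 0)) t x + vd s *\<^sub>R d1 (field (amp_G j) (\<Psi> 0) t) x = Gd s j *\<^sub>R d1 (field amp_v (\<Psi> 0) t) x" for j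
      using stretching_balance by (simp add: eqs)
  next
    fix t :: real and s x1 assume t: "0 \<le> t"
    show "dt (front_of (\<psi> 0)) t x1 = side_trace s (\<lambda>x. snd (field amp_v (\<Psi> 0) t x)) x1 - vd s * pd 1 (front_of (\<psi> 0) t) x1"
      unfolding trace_v front_pd front_dt[OF t]
      by (simp add: sigma_def algebra_simps)
  qed
  \<comment> \<open>Opposite velocities give
    \<open>sigma Plus - sigma Minus = 2 * \<i> * vd Plus\<close>; against the profile
    \<open>- \<i> * \<psi> 1\<close> this is the required jump of the normal velocity.\<close>
  moreover have "boundary_B vd Gd (front_of (\<psi> 0)) (field amp_h (\<Psi> 0)) (field amp_v (\<Psi> 0))
      (\<lambda>j. field (amp_G j) (\<Psi> 0))"
    unfolding boundary_B_def jump_def trace_h trace_G front_pd amp_h_jump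
    using vd by (simp add: inner_prod_def trace_v sigma_def algebra_simps)
  ultimately show ?thesis
    unfolding solution_def classical_front_def
    by (auto intro!: field_classical[OF chain(2)] field_curve[OF \<Psi>])
qed

end

section \<open>Growth of the packets and the sequence of solutions\<close>

lemma power_fact_le_exp:
  assumes "0 \<le> (x::real)"
  shows "x ^ n / fact n \<le> exp x"
proof -
  have "(\<Sum>i\<in>{n}. x ^ i /\<^sub>R fact i) \<le> (\<Sum>i. x ^ i /\<^sub>R fact i)"
    using assms by (intro sum_le_suminf summable_exp_generic) auto
  then show ?thesis by (simp add: exp_def divide_inverse mult.commute)
qed

lemma sobolev_square_integrable: "u \<in> sobolev U k \<Longrightarrow> u square_integrable_on U"
  unfolding sobolev_def weak_jet_def multi_indices_def by fastforce

context unstable_mode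
begin

text \<open>The order-zero part of the norm already grows: on an interval of length
  \<open>1 / n\<close> about the origin the packet is nearly in phase and has size
  \<open>exp (n * lam * t)\<close>.\<close>

lemma front_sobolev_norm_ge:
  assumes n: "1 \<le> n" and A: "0 \<le> A" and t: "0 < t"
  shows "A * exp (real n * (lam * t)) / (2 * real n) \<le> sobolev_norm UNIV k (front_of (wave A n 0) t)"
proof -
  let ?u = "front_of (wave A n 0) t"
  have adm: "admissible (wave A n)" using n by (rule wave_admissible)
  then have chain: "derivative_chain (wave A n)" by (simp add: admissible_def)
  obtain C where C: "0 \<le> C" "\<And>m. m \<le> k \<Longrightarrow> decays (wave A n m) (lam * t) C"
    using admissible_uniform[OF adm] by blast
  have nonneg: "0 \<le> lam * t" using lam t by simp
  have front: "?u x = Re (wave A n 0 (of_real x - \<i> * of_real (lam * t)))" for x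
    by (simp add: front_of_def)
  have "?u \<in> sobolev UNIV k"
    and L2: "sqrt (LINT x:UNIV|lebesgue. (norm (?u x))\<^sup>2) \<le> sobolev_norm UNIV k ?u"
    by (rule wave_domain.wave_sobolev(1,4)[OF wave_domain_real chain bounded_linear_Re C nonneg order_refl],
        assumption, rule front)+
  then have "set_integrable lebesgue UNIV (\<lambda>x. (norm (?u x))\<^sup>2)"
    using sobolev_square_integrable unfolding square_integrable_on_def by blast
  then have int: "integrable lebesgue (\<lambda>x. (norm (?u x))\<^sup>2)"
    by (simp add: set_integrable_def)
  let ?a = "1 / (2 * real n)" and ?M = "A * exp (real n * (lam * t)) / 2"
  \<comment> \<open>On this interval the rescaled variable \<open>n * x\<close> has modulus at most
    1/2, as \<open>packet_lower\<close> requires.\<close>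
  have lower: "?M \<le> ?u x" if "x \<in> {- ?a..?a}" for x
  proof -
    have "\<bar>real n * x\<bar> \<le> real n * ?a"
      unfolding abs_mult using that by (intro mult_mono) auto
    then have "\<bar>real n * x\<bar> \<le> 1 / 2" using n by simp
    then have "exp (real n * (lam * t)) / 2 \<le> Re (packet (of_real (real n * x) - \<i> * of_real (real n * (lam * t))))"
      using n lam t by (intro packet_lower) auto
    from mult_left_mono[OF this A] show ?thesis
      by (simp add: front wave_def right_diff_distrib mult.left_commute)
  qed
  have "?M\<^sup>2 / real n = integral\<^sup>L lebesgue (\<lambda>x. indicator {- ?a..?a} x *\<^sub>R ?M\<^sup>2)"
    using n by simp
  also have "\<dots> \<le> integral\<^sup>L lebesgue (\<lambda>x. (norm (?u x))\<^sup>2)"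
  proof (rule integral_mono[OF _ int])
    show "integrable lebesgue (\<lambda>x. indicator {- ?a..?a} x *\<^sub>R ?M\<^sup>2)"
      by (intro integrable_scaleR_left integrable_real_indicator) (auto simp: emeasure_lborel_Icc_eq)
    show "indicator {- ?a..?a} x *\<^sub>R ?M\<^sup>2 \<le> (norm (?u x))\<^sup>2" for x
      using power_mono[OF lower, of x 2] A by (cases "x \<in> {- ?a..?a}") auto
  qed
  finally have "sqrt (?M\<^sup>2 / real n) \<le> sobolev_norm UNIV k ?u"
    using L2 by (simp add: set_lebesgue_integral_def) (meson order_trans real_sqrt_le_mono)
  \<comment> \<open>The root of \<open>1 / n\<close> is weakened to \<open>1 / n\<close> to keep
    integer powers.\<close>
  moreover have "(?M / real n)\<^sup>2 \<le> ?M\<^sup>2 / real n"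
    using n unfolding power_divide by (intro divide_left_mono) (auto simp: power2_eq_square)
  then have "?M / real n \<le> sqrt (?M\<^sup>2 / real n)"
    by (rule real_le_rsqrt)
  ultimately show ?thesis by simp
qed

text \<open>At time 0 there is no shift, so the decay constants contain no exponential in
  \<open>n\<close>. The power is \<open>Suc k\<close> because the fields carry one derivative more
  than the front.\<close>

lemma mode_initial_norm:
  assumes n: "1 \<le> n" and A: "0 \<le> A" and l: "l \<in> {1, 2}"
  defines "\<Psi> \<equiv> \<lambda>m z. - \<i> * wave A n (Suc m) z"
  shows "state_norm k (front_of (wave A n 0) 0) (field amp_h (\<Psi> 0) 0) (field amp_v (\<Psi> 0) 0) (field (amp_G l) (\<Psi> 0) 0)
    \<le> A * real n ^ Suc k * (8 * exp 2 * fact (Suc k)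
        * (profile_const UNIV k Re of_real (\<lambda>x::real. inverse (1 + x\<^sup>2)) + bound_const k amp_h + bound_const k amp_v
          + \<bar>bound_const k (amp_G 1)\<bar> + \<bar>bound_const k (amp_G 2)\<bar>))"
proof -
  define C where "C = A * real n ^ Suc k * (8 * exp 2 * fact (Suc k))"
  have C: "0 \<le> C" using A by (simp add: C_def)
  have decays_wave: "decays (wave A n m) 0 C" if "m \<le> Suc k" for m
  proof (rule decays_mono)
    show "decays (wave A n m) 0 (\<bar>A\<bar> * real n ^ m * (8 * exp 2 * fact m) * exp (2 * real n * 0))"
      using n by (rule wave_decays) simp
    show "\<bar>A\<bar> * real n ^ m * (8 * exp 2 * fact m) * exp (2 * real n * 0) \<le> C"
    proof -
      have "real n ^ m \<le> real n ^ Suc k" "(fact m :: real) \<le> fact (Suc k)"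
        using n that by (intro power_increasing fact_mono; simp)+
      then have "A * real n ^ m * (8 * exp 2 * fact m) \<le> A * real n ^ Suc k * (8 * exp 2 * fact (Suc k))"
        using A by (intro mult_mono) auto
      then show ?thesis using A by (simp add: C_def)
    qed
  qed
  have decays_\<Psi>: "decays (\<Psi> m) 0 C" if "m \<le> k" for m
    using decays_wave[of "Suc m"] that by (simp add: decays_def \<Psi>_def norm_mult)
  have adm: "admissible (wave A n)" using n by (rule wave_admissible)
  have "admissible \<Psi>" unfolding \<Psi>_def by (rule admissible_shift[OF adm])
  then have chain: "derivative_chain (wave A n)" "derivative_chain \<Psi>" using adm by (simp_all add: admissible_def)
  have "sobolev_norm UNIV k (front_of (wave A n 0) 0)
      \<le> C * exp 0 * profile_const UNIV k Re of_real (\<lambda>x::real. inverse (1 + x\<^sup>2))"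
    by (rule wave_domain.wave_sobolev(3)[OF wave_domain_real chain(1) bounded_linear_Re C decays_wave order_refl order_refl])
       (auto simp: front_of_def)
  moreover have "piecewise_sobolev_norm k (field amp_h (\<Psi> 0) 0) \<le> C * bound_const k amp_h"
    "piecewise_sobolev_norm k (field amp_v (\<Psi> 0) 0) \<le> C * bound_const k amp_v"
    "piecewise_sobolev_norm k (field (amp_G l) (\<Psi> 0) 0) \<le> C * bound_const k (amp_G l)"
    by (rule field_initial_norm[OF chain(2) _ C decays_\<Psi>]; simp)+
  \<comment> \<open>Adding both absolute values gives one constant valid for \<open>l = 1\<close>
    and \<open>l = 2\<close>.\<close>
  moreover have "C * bound_const k (amp_G l) \<le> C * (\<bar>bound_const k (amp_G 1)\<bar> + \<bar>bound_const k (amp_G 2)\<bar>)"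
    using l C by (intro mult_left_mono) auto
  ultimately have "state_norm k (front_of (wave A n 0) 0) (field amp_h (\<Psi> 0) 0) (field amp_v (\<Psi> 0) 0) (field (amp_G l) (\<Psi> 0) 0)
      \<le> C * (profile_const UNIV k Re of_real (\<lambda>x::real. inverse (1 + x\<^sup>2)) + bound_const k amp_h + bound_const k amp_v
          + \<bar>bound_const k (amp_G 1)\<bar> + \<bar>bound_const k (amp_G 2)\<bar>)"
    unfolding state_norm_def by (simp add: distrib_left)
  then show ?thesis by (simp only: C_def mult.assoc)
qed

text \<open>Polynomial size at time 0 is beaten by exponential growth in \<open>n\<close>, uniformly
  from time \<open>T0\<close> on since the lower bound increases with \<open>t\<close>.\<close>

lemma ill_posed:
  assumes T0: "0 < T0" and \<alpha>: "0 < \<alpha>"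
  shows "\<exists>(f :: nat \<Rightarrow> front) (h :: nat \<Rightarrow> scalar_field) (v :: nat \<Rightarrow> vector_field) (G :: nat \<Rightarrow> nat \<Rightarrow> vector_field).
    (\<forall>n\<ge>1. solution c vd Gd j (f n) (h n) (v n) (G n)) \<and>
    (\<exists>C>0. \<forall>n\<ge>1. \<forall>l\<in>{1,2}. state_norm j (f n 0) (h n 0) (v n 0) (G n l 0) \<le> C * (1 / real n)) \<and>
    (\<forall>n\<ge>1. \<forall>l\<in>{1,2}. \<forall>t\<ge>T0. state_norm k (f n t) (h n t) (v n t) (G n l t) \<ge> \<alpha>)"
proof -
  \<comment> \<open>\<open>A0\<close> makes the Taylor bound \<open>x ^ (j + 3) / fact (j + 3) \<le> exp x\<close> give exactly \<open>\<alpha>\<close> at time \<open>T0\<close>.\<close>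
  define A0 where "A0 = 2 * \<alpha> * fact (j + 3) / (lam * T0) ^ (j + 3)"
  have A0: "0 < A0" using T0 \<alpha> lam by (simp add: A0_def)
  \<comment> \<open>Initial data grow like \<open>n ^ (j + 1)\<close>, so this scaling leaves
    \<open>1 / n\<close>. At \<open>T0\<close> the Taylor bound supplies \<open>n ^ (j + 3)\<close>,
    which absorbs this power together with the loss of \<open>1 / n\<close> in the front
    bound.\<close>
  define A where "A = (\<lambda>n. A0 / real n ^ (j + 2))"
  have A: "0 \<le> A n" for n using A0 by (simp add: A_def)
  define \<Psi> where "\<Psi> = (\<lambda>n m z. - \<i> * wave (A n) n (Suc m) z)"
  define f where "f = (\<lambda>n. front_of (wave (A n) n 0))"
  define h where "h = (\<lambda>n. field amp_h (\<Psi> n 0))"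
  define v where "v = (\<lambda>n. field amp_v (\<Psi> n 0))"
  define G where "G = (\<lambda>n l. field (amp_G l) (\<Psi> n 0))"
  have sol: "solution c vd Gd j (f n) (h n) (v n) (G n)" if "1 \<le> n" for n
    unfolding f_def h_def v_def G_def \<Psi>_def by (rule mode_solution[OF wave_admissible[OF that]])
  define D where "D = 8 * exp 2 * fact (Suc j)
        * (profile_const UNIV j Re of_real (\<lambda>x::real. inverse (1 + x\<^sup>2)) + bound_const j amp_h + bound_const j amp_v
          + \<bar>bound_const j (amp_G 1)\<bar> + \<bar>bound_const j (amp_G 2)\<bar>)"
  have init: "state_norm j (f n 0) (h n 0) (v n 0) (G n l 0) \<le> (A0 * \<bar>D\<bar> + 1) * (1 / real n)"
    if n: "1 \<le> n" and l: "l \<in> {1, 2}" for n l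
  proof -
    have "state_norm j (f n 0) (h n 0) (v n 0) (G n l 0) \<le> A n * real n ^ Suc j * D"
      unfolding f_def h_def v_def G_def \<Psi>_def D_def by (rule mode_initial_norm[OF n A l])
    also have "A n * real n ^ Suc j = A0 * (1 / real n)"
      using n by (simp add: A_def)
    \<comment> \<open>The absolute value and the added 1 produce a strictly positive constant
      independent of \<open>n\<close> and \<open>l\<close>.\<close>
    also have "A0 * (1 / real n) * D \<le> (A0 * \<bar>D\<bar> + 1) * (1 / real n)"
    proof -
      have "A0 * D \<le> A0 * \<bar>D\<bar> + 1" using A0 by (simp add: add_increasing2)
      then have "A0 * D * (1 / real n) \<le> (A0 * \<bar>D\<bar> + 1) * (1 / real n)"
        by (rule mult_right_mono) simp
      then show ?thesis by (simp add: ac_simps)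
    qed
    finally show ?thesis .
  qed
  have grow: "\<alpha> \<le> state_norm k (f n t) (h n t) (v n t) (G n l t)"
    if n: "1 \<le> n" and t: "T0 \<le> t" for n l t
  proof -
    have "\<alpha> = A n * ((real n * (lam * T0)) ^ (j + 3) / fact (j + 3)) / (2 * real n)"
      using n lam T0 by (simp add: A_def A0_def power_mult_distrib power_add eval_nat_numeral)
    also have "\<dots> \<le> A n * exp (real n * (lam * T0)) / (2 * real n)"
      using lam T0 by (intro divide_right_mono mult_left_mono power_fact_le_exp A) auto
    also have "\<dots> \<le> A n * exp (real n * (lam * t)) / (2 * real n)"
      using lam t by (intro divide_right_mono mult_left_mono A) (auto intro!: mult_left_mono)
    also have "\<dots> \<le> sobolev_norm UNIV k (f n t)"
      unfolding f_def using T0 t by (intro front_sobolev_norm_ge n A) simp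
    \<comment> \<open>The front alone grows enough; the other summands are values of
      \<open>sqrt\<close> at sums of squares, hence nonnegative.\<close>
    also have "\<dots> \<le> state_norm k (f n t) (h n t) (v n t) (G n l t)"
      by (simp add: state_norm_def piecewise_sobolev_norm_def)
    finally show ?thesis .
  qed
  have "0 < A0 * \<bar>D\<bar> + 1" using A0 by (simp add: add_nonneg_pos)
  then show ?thesis using sol init grow by blast
qed

end

section \<open>The growth rate as a root of the dispersion relation\<close>

lemma growth_rate_exists:
  fixes c v Q :: real
  assumes c: "0 < c" and lower: "Q < v\<^sup>2" and upper: "v\<^sup>2 < 2 * c\<^sup>2 + Q"
  shows "\<exists>lam>0. norm (1 + ((of_real lam + \<i> * of_real v)\<^sup>2 + of_real Q) / of_real (c\<^sup>2) :: complex) = 1"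
proof -
  let ?z = "\<lambda>lam. 1 + ((of_real lam + \<i> * of_real v)\<^sup>2 + of_real Q) / of_real (c\<^sup>2) :: complex"
  \<comment> \<open>At rate 0 the number is real; the two hypotheses say exactly that it lies
    strictly between -1 and 1.\<close>
  have z0: "norm (?z 0) < 1"
  proof -
    have "?z 0 = of_real (1 + (Q - v\<^sup>2) / c\<^sup>2)"
      by (simp add: power_mult_distrib add_divide_distrib diff_divide_distrib)
    moreover have "\<bar>1 + (Q - v\<^sup>2) / c\<^sup>2\<bar> < 1"
      using assms by (simp add: abs_less_iff field_simps)
    ultimately show ?thesis by (simp only: norm_of_real)
  qed
  \<comment> \<open>At rate \<open>2 * c\<close> the square contributes
    \<open>4 * c\<^sup>2\<close>, more than \<open>v\<^sup>2 - Q\<close>. The intermediate value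
    theorem then yields modulus 1 in between.\<close>
  have "1 < Re (?z (2 * c))"
    using assms by (simp add: power2_eq_square field_simps)
  then have z1: "1 < norm (?z (2 * c))"
    using complex_Re_le_cmod[of "?z (2 * c)"] by linarith
  have "\<exists>lam\<ge>0. lam \<le> 2 * c \<and> norm (?z lam) = 1"
  proof (rule IVT')
    show "continuous_on {0..2 * c} (\<lambda>lam. norm (?z lam))"
      using c by (intro continuous_intros) auto
  qed (use z0 z1 c in auto)
  then obtain lam where lam: "0 \<le> lam" "norm (?z lam) = 1" by blast
  moreover have "lam \<noteq> 0" using z0 lam(2) by auto
  ultimately show ?thesis by (intro exI[of _ lam]) auto
qed

text \<open>On the upper side \<nu> is the square root with positive real part of the number
  \<open>w\<close> on the unit circle; reflection and conjugation give the lower side.\<close>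

lemma unstable_mode_exists:
  fixes c :: real and vd :: "side \<Rightarrow> real" and Gd :: "side \<Rightarrow> nat \<Rightarrow> real"
  assumes c: "0 < c" and vd: "vd Plus = - vd Minus" and Gd: "\<forall>j\<in>{1,2}. Gd Plus j = - Gd Minus j"
    and lower: "(Gd Plus 1)\<^sup>2 + (Gd Plus 2)\<^sup>2 < (vd Plus)\<^sup>2"
    and upper: "(vd Plus)\<^sup>2 < 2 * c\<^sup>2 + ((Gd Plus 1)\<^sup>2 + (Gd Plus 2)\<^sup>2)"
  shows "\<exists>lam nu. unstable_mode c lam vd Gd nu"
proof -
  define Q where "Q = (Gd Plus 1)\<^sup>2 + (Gd Plus 2)\<^sup>2"
  define v where "v = vd Plus"
  obtain lam where lam: "0 < lam"
    and unit: "norm (1 + ((of_real lam + \<i> * of_real v)\<^sup>2 + of_real Q) / of_real (c\<^sup>2) :: complex) = 1"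
    using growth_rate_exists[OF c lower upper] by (auto simp: Q_def v_def)
  define w :: complex where "w = 1 + ((of_real lam + \<i> * of_real v)\<^sup>2 + of_real Q) / of_real (c\<^sup>2)"
  define \<mu> where "\<mu> = csqrt w"
  have \<mu>2: "\<mu>\<^sup>2 = w" by (simp add: \<mu>_def)
  have norm_\<mu>: "norm \<mu> = 1"
    using unit by (simp add: \<mu>_def w_def norm_csqrt)
  \<comment> \<open>Both the rate and the velocity are nonzero, so \<open>w\<close> has nonzero
    imaginary part; this excludes a purely imaginary root, which would not decay.\<close>
  have "v \<noteq> 0" using lower by (auto simp: v_def not_sum_power2_lt_zero)
  have "Im w = 2 * lam * v / c\<^sup>2"
    by (simp add: w_def power2_eq_square)
  then have "Im w \<noteq> 0" using lam c \<open>v \<noteq> 0\<close> by simp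
  moreover have "Im w = 2 * Re \<mu> * Im \<mu>"
    unfolding \<mu>2[symmetric] by (simp add: power2_eq_square)
  ultimately have "Re \<mu> \<noteq> 0" by auto
  moreover have "0 \<le> Re \<mu>" using csqrt_principal[of w] by (auto simp: \<mu>_def)
  ultimately have Re_\<mu>: "0 < Re \<mu>" by simp
  have inverse_\<mu>: "inverse \<mu> = cnj \<mu>"
    unfolding inverse_eq_divide by (subst complex_div_cnj) (simp add: norm_\<mu>)
  have disp: "of_real (c\<^sup>2) * (\<mu>\<^sup>2 - 1) = (of_real lam + \<i> * of_real v)\<^sup>2 + of_real Q"
    using c by (simp add: \<mu>2 w_def)
  \<comment> \<open>The lower side carries the conjugate data; \<open>\<bar>\<mu>\<bar> = 1\<close> turns \<open>\<nu> - 1 / \<nu>\<close> into \<open>2 \<i> Im \<mu>\<close> on both sides.\<close>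
  define nu where "nu = (\<lambda>s. case s of Plus \<Rightarrow> \<mu> | Minus \<Rightarrow> - cnj \<mu>)"
  have "unstable_mode c lam vd Gd nu"
  proof
    show "0 < lam" "vd Plus = - vd Minus" by fact+
    show "norm (nu s) = 1" for s by (cases s) (simp_all add: nu_def norm_\<mu>)
    show "0 < Re (nu s) * snd x" if "x \<in> halfplane s" for s x
      using that Re_\<mu> by (cases s) (auto simp: nu_def mult_pos_neg)
    have "inverse (cnj \<mu>) = \<mu>" by (simp add: inverse_\<mu> flip: complex_cnj_inverse)
    then show "nu Plus - inverse (nu Plus) = nu Minus - inverse (nu Minus)"
      by (simp add: nu_def inverse_\<mu>)
    have GQ: "(Gd s 1)\<^sup>2 + (Gd s 2)\<^sup>2 = Q" for s
      using Gd by (cases s) (simp_all add: Q_def)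
    show "of_real (c\<^sup>2) * ((nu s)\<^sup>2 - 1)
      = (of_real lam + \<i> * of_real (vd s))\<^sup>2 + of_real ((Gd s 1)\<^sup>2 + (Gd s 2)\<^sup>2)" for s
    proof (cases s)
      case Plus then show ?thesis using disp unfolding GQ by (simp add: nu_def v_def)
    next
      case Minus
      \<comment> \<open>Conjugating the dispersion relation flips the sign of the velocity, and
        \<open>- cnj \<mu>\<close> squares to the conjugate of \<open>w\<close>.\<close>
      have "vd Minus = - v" using vd by (simp add: v_def)
      with Minus show ?thesis using arg_cong[OF disp, of cnj] unfolding GQ by (simp add: nu_def)
    qed
  qed
  then show ?thesis by blast
qed

theorem lemma4p3:
  fixes c K M \<epsilon>0 :: real
    and vd :: "side \<Rightarrow> real"
    and Gd :: "side \<Rightarrow> nat \<Rightarrow> real"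
  assumes "c > 0"
    and "vd Plus = - vd Minus"
    and "\<forall>j\<in>{1,2}. Gd Plus j = - Gd Minus j"
    and "K = sqrt (((Gd Plus 1)\<^sup>2 + (Gd Plus 2)\<^sup>2) / c\<^sup>2)"
    and "M = \<bar>vd Plus\<bar> / c"
    and "\<epsilon>0 > 0"
    and "K + \<epsilon>0 \<le> M"
    and "M \<le> sqrt (2 + K\<^sup>2) - \<epsilon>0"
  shows "\<forall>k j :: nat. \<forall>T0 \<alpha> :: real. j \<ge> k \<longrightarrow> T0 > 0 \<longrightarrow> \<alpha> > 0 \<longrightarrow>
    (\<exists>(f :: nat \<Rightarrow> front) (h :: nat \<Rightarrow> scalar_field)
       (v :: nat \<Rightarrow> vector_field) (G :: nat \<Rightarrow> nat \<Rightarrow> vector_field).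
       (\<forall>n\<ge>1. solution c vd Gd j (f n) (h n) (v n) (G n)) \<and>
       (\<exists>C>0. \<forall>n\<ge>1. \<forall>l\<in>{1,2}.
          state_norm j (f n 0) (h n 0) (v n 0) (G n l 0) \<le> C * (1 / real n)) \<and>
       (\<forall>n\<ge>1. \<forall>l\<in>{1,2}. \<forall>t\<ge>T0.
          state_norm k (f n t) (h n t) (v n t) (G n l t) \<ge> \<alpha>))"
proof -
  define Q where "Q = (Gd Plus 1)\<^sup>2 + (Gd Plus 2)\<^sup>2"
  have K2: "K\<^sup>2 = Q / c\<^sup>2" and K: "0 \<le> K"
    using assms(4) by (simp_all add: Q_def)
  have M2: "M\<^sup>2 = (vd Plus)\<^sup>2 / c\<^sup>2" and M: "0 \<le> M"
    using assms(1,5) by (simp_all add: power_divide)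
  \<comment> \<open>The margin \<open>\<epsilon>0\<close> makes both bounds strict; squaring and
    clearing the factor \<open>c\<^sup>2\<close> turns them into the two conditions on
    \<open>vd Plus\<close> used above.\<close>
  have "K\<^sup>2 < M\<^sup>2"
    using assms(6,7) K by (intro power_strict_mono) auto
  then have lower: "Q < (vd Plus)\<^sup>2"
    using assms(1) by (simp add: K2 M2 divide_less_cancel)
  have "M\<^sup>2 < (sqrt (2 + K\<^sup>2))\<^sup>2"
    using assms(6,8) M by (intro power_strict_mono) auto
  then have "M\<^sup>2 < 2 + K\<^sup>2" by simp
  then have upper: "(vd Plus)\<^sup>2 < 2 * c\<^sup>2 + Q"
    using assms(1) by (simp add: K2 M2 field_simps)
  obtain lam nu where "unstable_mode c lam vd Gd nu"
    using unstable_mode_exists[OF assms(1-3)] lower upper unfolding Q_def by blast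
  then show ?thesis
    by (intro allI impI unstable_mode.ill_posed)
qed

end
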